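(* Let $p$ be a prime and let $r\ge 0$ be an integer. (i) If $p>r+3$ then $$\sum_{k=1}^{p-1}\frac{\binom{2k}{k}}{k\,4^k}\,S_k(\{1\}^r)\equiv\begin{cases}-H^{(r+1)}_{(p-1)/2}&\text{if } r \text{ is even},\\[2mm] \dfrac{2^{r+2}-1}{2(r+2)}\,p\,B_{p-r-2}&\text{if } r\text{ is odd},\end{cases}\pmod{p^2}.$$ (ii) If $p>2r+3$ then $$\sum_{k=1}^{p-1}\frac{\binom{2k}{k}^2}{k\,16^k}\,S_k(\{2\}^r)\equiv -2H^{(2r+1)}_{(p-1)/2}-\frac{r(2^{2r+3}-1)}{2}\,p^2B_{p-2r-3}\pmod{p^3}.$$
   Context: Congruences modulo $p^a$ are between rational numbers with denominators prime to $p$ (equivalently, in the $p$-adic integers $\mathbb{Z}_p$). $B_n$ is the $n$-th Bernoulli number. For $t\ge1$, $H_n^{(t)}:=\sum_{j=1}^n\frac1{j^t}$. For positive integers $t_1,\dots,t_r$, $$S_n(t_1,\dots,t_r):=\sum_{1\le j_1\le\cdots\le j_r\le n}\frac{1}{j_1^{t_1}\cdots j_r^{t_r}},$$ and $S_n(\{t\}^r)$ denotes $S_n(t,\dots,t)$ with $t$ repeated $r$ times; for $r=0$, $S_n(\{t\}^0)=1$. *)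

theory Defs
  imports Complex_Main "HOL-Computational_Algebra.Computational_Algebra"
begin

definition p_integral :: "nat \<Rightarrow> rat \<Rightarrow> bool" where
  "p_integral p x \<longleftrightarrow> coprime (int p) (snd (quotient_of x))"

text \<open>Congruence modulo \<open>p ^ a\<close> in the ring of rationals with denominator prime to \<open>p\<close>;
  integrality of both sides is part of the assertion.\<close>

definition rat_cong_pow :: "nat \<Rightarrow> nat \<Rightarrow> rat \<Rightarrow> rat \<Rightarrow> bool" where
  "rat_cong_pow p a x y \<longleftrightarrow>
     p_integral p x \<and> p_integral p y \<and>
     (\<exists>z. p_integral p z \<and> x - y = of_nat p ^ a * z)"

text \<open>The usual recursion \<open>\<Sum>k\<le>n. (n + 1 choose k) * B k = 0\<close> for \<open>n > 0\<close>,
  solved for \<open>B n\<close>; in particular \<open>B 1 = - 1 / 2\<close>.\<close>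

fun bernoulli :: "nat \<Rightarrow> rat" where
  "bernoulli n =
     (if n = 0 then 1
      else - (\<Sum>k<n. of_nat (Suc n choose k) * bernoulli k) / of_nat (Suc n))"

declare bernoulli.simps [simp del]

definition harm_pow :: "nat \<Rightarrow> nat \<Rightarrow> rat" where
  "harm_pow t n = (\<Sum>j=1..n. 1 / of_nat j ^ t)"

text \<open>The summation indices \<open>1 \<le> j\<^sub>1 \<le> \<dots> \<le> j\<^sub>r \<le> n\<close> are the sorted lists of length \<open>r\<close>
  over \<open>{1..n}\<close>, where \<open>r\<close> is the length of the exponent list \<open>ts\<close>.\<close>

definition mult_harm_star :: "nat \<Rightarrow> nat list \<Rightarrow> rat" where
  "mult_harm_star n ts =
     (\<Sum>js\<in>{js. length js = length ts \<and> sorted js \<and> set js \<subseteq> {1..n}}.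
        \<Prod>i<length ts. 1 / of_nat (js ! i) ^ (ts ! i))"

end

theory Submission
  imports Defs "HOL-Number_Theory.Residues"
begin

text \<open>
  For \<open>m = (p - 1) / 2\<close> one has \<open>binom(2k, k) / 4\<^sup>k = (1/2)\<^sub>k / k!\<close> (rising factorial), and
  \<open>1/2 \<plusminus> p/2\<close> are the integers \<open>m + 1\<close> and \<open>- m\<close>. Replace \<open>1/2\<close> by a parameter \<open>a\<close> in the
  sum: its difference in \<open>a\<close> telescopes, so that its value at every integer \<open>a\<close> is explicit.
  Modulo \<open>p\<^sup>2\<close>, \<open>(1/2)\<^sub>k\<close> is the mean of \<open>(1/2 + p/2)\<^sub>k\<close> and \<open>(1/2 - p/2)\<^sub>k\<close>. For the squares,
  \<open>(a)\<^sub>k (1 - a)\<^sub>k\<close> with \<open>a = 1/2 + u\<close> is a polynomial in \<open>u\<^sup>2\<close>, and its values at \<open>u = p/2\<close> and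
  \<open>u = 3p/2\<close> extrapolate to \<open>u = 0\<close> modulo \<open>p\<^sup>4\<close>. What remains are power sums of
  inverses; these are reduced to Bernoulli numbers by pairing \<open>j\<close> with \<open>p - j\<close>, by comparing the
  even and the odd \<open>j\<close>, and by a congruence of Kummer type.
\<close>

section \<open>Multiple harmonic sums and telescoping identities\<close>

text \<open>The coefficients beside the Pochhammer symbols, namely 1/k!, 1/k and S_k, are p-integral
  because k < p, so congruences between Pochhammer symbols pass to the sums term by term. A single
  value at u = p/2 would fix the quadratic sum at u = 0 only modulo p^2; u = 3p/2 is the next
  multiple of p/2 for which a = 1/2 + u is an integer. The obstacle is that the telescoping is free
  of boundary terms only while the boundary product vanishes: the exact evaluations reach -(p-1) <=
  a <= 0 in the linear case and 1 <= a <= p in the quadratic one. The points m + 1 (linear) and p +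
  m + 1 (quadratic) lie outside. On the way to them each step carries a boundary term divisible by
  p, respectively p^2. For larger r this term is multiplied by a sum S_(p-1) that is itself
  divisible by p, so only its contribution at r = 0 survives. The steps at a = 0 and a = p are
  exceptional: there the recursion yields a full star sum up to p - 1.\<close>

definition hstar :: "nat \<Rightarrow> nat \<Rightarrow> nat \<Rightarrow> rat" where
  "hstar t n r = mult_harm_star n (replicate r t)"

lemma hstar_0: "hstar t n 0 = 1"
proof -
  have "{js :: nat list. length js = 0 \<and> sorted js \<and> set js \<subseteq> {1..n}} = {[]}" by auto
  then show ?thesis by (simp add: hstar_def mult_harm_star_def)
qed

lemma hstar_Suc_0: "hstar t 0 (Suc r) = 0"
proof -
  have "{js :: nat list. length js = length (replicate (Suc r) t) \<and> sorted js \<and> set js \<subseteq> {1..0}} = {}"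
    by auto
  then show ?thesis unfolding hstar_def mult_harm_star_def by (simp only: sum.empty)
qed

lemma hstar_Suc_Suc:
  "hstar t (Suc n) (Suc r) = hstar t n (Suc r) + hstar t (Suc n) r / of_nat (Suc n) ^ t"
proof -
  define A where "A n r = {js :: nat list. length js = r \<and> sorted js \<and> set js \<subseteq> {1..n}}" for n r
  define w :: "nat list \<Rightarrow> rat" where "w js = (\<Prod>i<length js. 1 / of_nat (js ! i) ^ t)" for js
  have h: "hstar t n r = sum w (A n r)" for n r
    unfolding hstar_def mult_harm_star_def A_def w_def
    by (intro sum.cong prod.cong) auto
  have fin: "finite (A n r)" for n r
    by (rule finite_subset[OF _ finite_lists_length_eq[of "{1..n}" r]]) (auto simp: A_def)
  let ?app = "\<lambda>js. js @ [Suc n]"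
  have split: "A (Suc n) (Suc r) = A n (Suc r) \<union> ?app ` A (Suc n) r"
  proof (intro equalityI subsetI)
    fix js assume js: "js \<in> A (Suc n) (Suc r)"
    then have "js \<noteq> []" by (auto simp: A_def)
    then have dec: "js = butlast js @ [last js]" by simp
    have srt: "sorted (butlast js @ [last js])" using js by (simp add: A_def \<open>js \<noteq> []\<close>)
    have le: "x \<le> last js" if "x \<in> set js" for x
    proof -
      have "x \<in> set (butlast js @ [last js])" using that dec by simp
      then show ?thesis using srt by (auto simp: sorted_append)
    qed
    have "last js \<in> {1..Suc n}" using js \<open>js \<noteq> []\<close> last_in_set[of js] unfolding A_def by blast
    show "js \<in> A n (Suc r) \<union> ?app ` A (Suc n) r"
    proof (cases "last js = Suc n")
      case True
      have "butlast js \<in> A (Suc n) r"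
        using js srt in_set_butlastD[of _ js] by (auto simp: A_def sorted_append)
      then show ?thesis using dec True by force
    next
      case False
      with \<open>last js \<in> {1..Suc n}\<close> have "last js \<le> n" by simp
      then have "js \<in> A n (Suc r)" using js le by (fastforce simp: A_def)
      then show ?thesis by simp
    qed
  next
    fix js assume "js \<in> A n (Suc r) \<union> ?app ` A (Suc n) r"
    then show "js \<in> A (Suc n) (Suc r)" by (fastforce simp: A_def sorted_append)
  qed
  have disj: "A n (Suc r) \<inter> ?app ` A (Suc n) r = {}" by (auto simp: A_def)
  have inj: "inj_on ?app (A (Suc n) r)" by (auto simp: inj_on_def)
  have w: "w (js @ [Suc n]) = w js / of_nat (Suc n) ^ t" for js
    by (simp add: w_def nth_append)
  show ?thesis
    unfolding h split sum.union_disjoint[OF fin finite_imageI[OF fin] disj] sum.reindex[OF inj]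
    by (simp only: o_def w sum_divide_distrib)
qed

text \<open>Newton's identity for complete homogeneous symmetric polynomials and power sums in the
  variables 1/j^t. It is used at n = p - 1 to trade star sums for power sums of inverses. The outer
  induction adjoins one variable y.\<close>

lemma hstar_newton:
  "of_nat r * hstar t n r = (\<Sum>i=1..r. hstar t n (r - i) * harm_pow (t * i) n)"
proof (induction n arbitrary: r)
  case 0
  show ?case by (cases r) (simp_all add: hstar_Suc_0 harm_pow_def)
next
  case (Suc n)
  define y :: rat where "y = 1 / of_nat (Suc n) ^ t"
  have step: "hstar t (Suc n) (Suc r) = hstar t n (Suc r) + y * hstar t (Suc n) r" for r
    by (simp add: hstar_Suc_Suc y_def)
  have pw: "harm_pow (t * i) (Suc n) = harm_pow (t * i) n + y ^ i" for i
    by (simp add: harm_pow_def y_def power_mult power_divide)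
  \<comment> \<open>Sorting by the exponent of the new variable y: the generating function in X
    gains the factor 1/(1 - y X).\<close>
  have geo: "(\<Sum>i=0..r. y ^ i * hstar t n (r - i)) = hstar t (Suc n) r" for r
  proof (induction r)
    case 0
    show ?case by (simp add: hstar_0)
  next
    case (Suc r)
    have "(\<Sum>i=0..Suc r. y ^ i * hstar t n (Suc r - i)) =
      hstar t n (Suc r) + (\<Sum>i=0..r. y ^ Suc i * hstar t n (r - i))"
      by (subst sum.atLeast0_atMost_Suc_shift) simp
    also have "(\<Sum>i=0..r. y ^ Suc i * hstar t n (r - i)) = y * hstar t (Suc n) r"
      by (simp add: Suc[symmetric] sum_distrib_left mult.assoc)
    finally show ?case by (simp add: step)
  qed
  note outer = Suc.IH
  show ?case
  proof (induction r)
    case 0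
    show ?case by simp
  next
    case (Suc r)
    define D where "D N r = (\<Sum>i=1..r. hstar t N (r - i) * harm_pow (t * i) N)" for N r
    have "D (Suc n) (Suc r) =
      (\<Sum>i=1..r. hstar t (Suc n) (Suc (r - i)) * harm_pow (t * i) (Suc n)) + harm_pow (t * Suc r) (Suc n)"
      unfolding D_def by (simp add: hstar_0 Suc_diff_le)
    also have "\<dots> = (\<Sum>i=1..r. hstar t n (Suc (r - i)) * harm_pow (t * i) (Suc n))
        + harm_pow (t * Suc r) (Suc n) + y * D (Suc n) r"
      by (simp add: D_def step algebra_simps sum.distrib sum_distrib_left)
    also have "(\<Sum>i=1..r. hstar t n (Suc (r - i)) * harm_pow (t * i) (Suc n))
        + harm_pow (t * Suc r) (Suc n) = (\<Sum>i=1..Suc r. hstar t n (Suc r - i) * harm_pow (t * i) (Suc n))"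
      by (simp add: hstar_0 Suc_diff_le)
    also have "\<dots> = D n (Suc r) + (\<Sum>i=1..Suc r. y ^ i * hstar t n (Suc r - i))"
      unfolding pw by (simp add: D_def algebra_simps sum.distrib)
    also have "(\<Sum>i=1..Suc r. y ^ i * hstar t n (Suc r - i)) = y * (\<Sum>i=0..r. y ^ i * hstar t n (r - i))"
      unfolding One_nat_def sum.shift_bounds_cl_Suc_ivl by (simp add: sum_distrib_left mult.assoc)
    also have "\<dots> = y * hstar t (Suc n) r" by (simp only: geo)
    finally have "D (Suc n) (Suc r) = D n (Suc r) + y * hstar t (Suc n) r + y * D (Suc n) r" .
    moreover have "of_nat (Suc r) * hstar t n (Suc r) = D n (Suc r)"
      unfolding D_def by (rule outer)
    moreover have "of_nat r * hstar t (Suc n) r = D (Suc n) r"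
      unfolding D_def by (rule Suc.IH)
    moreover have "of_nat (Suc r) * hstar t (Suc n) (Suc r)
      = of_nat (Suc r) * hstar t n (Suc r) + y * hstar t (Suc n) r + y * (of_nat r * hstar t (Suc n) r)"
      by (simp add: step algebra_simps)
    ultimately show ?case unfolding D_def by simp
  qed
qed

section \<open>The linear sum as a function of the parameter a\<close>

definition lin_diff :: "rat \<Rightarrow> nat \<Rightarrow> nat \<Rightarrow> rat" where
  "lin_diff a n r = (\<Sum>k=1..n. pochhammer (a + 1) (k - 1) / fact k * hstar 1 k r)"

definition lin_sum :: "rat \<Rightarrow> nat \<Rightarrow> nat \<Rightarrow> rat" where
  "lin_sum a n r = (\<Sum>k=1..n. pochhammer a k / fact k / of_nat k * hstar 1 k r)"

text \<open>This is binom(a + n, n). Its increment from k - 1 to k is a times the k-th coefficient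
  in \<open>lin_diff\<close>.\<close>

definition lin_bdry :: "rat \<Rightarrow> nat \<Rightarrow> rat" where
  "lin_bdry a n = pochhammer (a + 1) n / fact n"

lemma lin_bdry_Suc: "lin_bdry a (Suc n) = lin_bdry a n * (a + of_nat (Suc n)) / of_nat (Suc n)"
  by (simp add: lin_bdry_def pochhammer_Suc algebra_simps)

lemma lin_diff_Suc_n:
  "lin_diff a (Suc n) r = lin_diff a n r + lin_bdry a n / of_nat (Suc n) * hstar 1 (Suc n) r"
  by (simp add: lin_diff_def lin_bdry_def field_simps)

lemma lin_diff_0: "a * lin_diff a n 0 = lin_bdry a n - 1"
proof (induction n)
  case (Suc n)
  define N :: rat where "N = of_nat (Suc n)"
  define c where "c = lin_bdry a n / N"
  have "lin_bdry a n = c * N" by (simp add: c_def N_def)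
  moreover have "lin_bdry a (Suc n) = c * (a + N)" by (simp add: lin_bdry_Suc c_def N_def)
  moreover have "lin_diff a (Suc n) 0 = lin_diff a n 0 + c"
    by (simp add: lin_diff_Suc_n c_def N_def hstar_0)
  ultimately show ?case using Suc by (simp add: algebra_simps)
qed (simp add: lin_diff_def lin_bdry_def)

text \<open>Summation by parts: a times the coefficients of \<open>lin_diff\<close> are the
  increments of \<open>lin_bdry\<close>, while the star sum with r + 1 entries grows at k by
  \<open>hstar 1 k r / of_nat k\<close>.\<close>

lemma lin_diff_Suc:
  "a * lin_diff a n (Suc r) + lin_diff a n r = lin_bdry a n * hstar 1 n (Suc r)"
proof (induction n)
  case (Suc n)
  define N :: rat where "N = of_nat (Suc n)"
  define c where "c = lin_bdry a n / N"
  define g where "g = hstar 1 (Suc n) r / N"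
  have "lin_bdry a n = c * N" by (simp add: c_def N_def)
  moreover have "lin_bdry a (Suc n) = c * (a + N)" by (simp add: lin_bdry_Suc c_def N_def)
  moreover have "hstar 1 (Suc n) r = g * N" by (simp add: g_def N_def)
  moreover have "hstar 1 (Suc n) (Suc r) = hstar 1 n (Suc r) + g"
    using hstar_Suc_Suc[of 1 n r] by (simp add: g_def N_def)
  moreover have "lin_diff a (Suc n) s = lin_diff a n s + c * hstar 1 (Suc n) s" for s
    by (simp add: lin_diff_Suc_n c_def N_def)
  ultimately show ?case using Suc by (simp add: algebra_simps)
qed (simp add: lin_diff_def hstar_Suc_0)

lemma lin_sum_diff: "lin_sum (a + 1) n r - lin_sum a n r = lin_diff a n r"
proof -
  have "pochhammer (a + 1) k / fact k / of_nat k - pochhammer a k / fact k / of_nat k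
      = pochhammer (a + 1) (k - 1) / fact k" if "k \<in> {1..n}" for k
  proof -
    from that obtain j where k: "k = Suc j" by (cases k) auto
    have "pochhammer (a + 1) k - pochhammer a k = of_nat k * pochhammer (a + 1) (k - 1)"
      unfolding k pochhammer_rec[of a] pochhammer_Suc[of "a + 1"] by (simp add: algebra_simps)
    moreover have "(of_nat k :: rat) \<noteq> 0" using that by simp
    ultimately show ?thesis by (simp add: field_simps)
  qed
  then show ?thesis
    unfolding lin_sum_def lin_diff_def sum_subtractf[symmetric]
    by (intro sum.cong refl) (simp only: left_diff_distrib[symmetric])
qed

lemma lin_sum_0: "lin_sum 0 n r = 0"
  by (simp add: lin_sum_def pochhammer_0_left)

text \<open>The Pochhammer symbol in the boundary term runs through 0 for these arguments, so
  raising r by one merely divides by j.\<close>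

lemma lin_diff_neg:
  assumes "1 \<le> j" "j \<le> n"
  shows "lin_diff (- of_nat j) n r = 1 / of_nat j ^ Suc r"
proof -
  from assms obtain i where i: "j = Suc i" by (cases j) auto
  have "pochhammer (- of_nat j + 1 :: rat) n = 0"
    using pochhammer_of_nat_eq_0_lemma[of i n, where 'a = rat] assms by (simp add: i)
  then have z: "lin_bdry (- of_nat j) n = 0" by (simp add: lin_bdry_def)
  have nz: "(of_nat j :: rat) \<noteq> 0" using assms by simp
  show ?thesis
  proof (induction r)
    case 0
    show ?case using lin_diff_0[of "- of_nat j" n] nz z by (simp add: field_simps)
  next
    case (Suc r)
    show ?case using lin_diff_Suc[of "- of_nat j" n r] nz z Suc by (simp add: field_simps)
  qed
qed

lemma lin_sum_neg:
  assumes "m \<le> n"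
  shows "lin_sum (- of_nat m) n r = - harm_pow (r + 1) m"
  using assms
proof (induction m)
  case (Suc m)
  have "lin_sum (- of_nat (Suc m) + 1) n r - lin_sum (- of_nat (Suc m)) n r = 1 / of_nat (Suc m) ^ Suc r"
    unfolding lin_sum_diff using lin_diff_neg[of "Suc m" n r] Suc by simp
  with Suc show ?case by (simp add: harm_pow_def)
qed (simp add: lin_sum_0 harm_pow_def)

section \<open>The quadratic sum as a function of the parameter a\<close>

definition quad_diff :: "rat \<Rightarrow> nat \<Rightarrow> nat \<Rightarrow> rat" where
  "quad_diff a n r =
     (\<Sum>k=1..n. pochhammer (a + 1) (k - 1) * pochhammer (1 - a) (k - 1) / fact k ^ 2 * hstar 2 k r)"

definition quad_sum :: "rat \<Rightarrow> nat \<Rightarrow> nat \<Rightarrow> rat" where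
  "quad_sum a n r =
     (\<Sum>k=1..n. pochhammer a k * pochhammer (1 - a) k / fact k ^ 2 / of_nat k * hstar 2 k r)"

text \<open>This is the product of 1 - a^2/i^2 over i = 1, ..., n; it vanishes at a = 1, ...,
  n.\<close>

definition quad_bdry :: "rat \<Rightarrow> nat \<Rightarrow> rat" where
  "quad_bdry a n = pochhammer (a + 1) n * pochhammer (1 - a) n / fact n ^ 2"

lemma quad_bdry_Suc:
  "quad_bdry a (Suc n) = quad_bdry a n * ((of_nat (Suc n)) ^ 2 - a ^ 2) / of_nat (Suc n) ^ 2"
proof -
  have "(a + 1 + of_nat n) * (1 - a + of_nat n) = of_nat (Suc n) ^ 2 - a ^ 2"
    by (simp add: power2_eq_square algebra_simps)
  then have "pochhammer (a + 1) (Suc n) * pochhammer (1 - a) (Suc n)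
      = pochhammer (a + 1) n * pochhammer (1 - a) n * (of_nat (Suc n) ^ 2 - a ^ 2)"
    by (simp only: pochhammer_Suc mult_ac)
  moreover have "(fact (Suc n) :: rat) ^ 2 = fact n ^ 2 * of_nat (Suc n) ^ 2"
    by (simp only: fact_Suc power_mult_distrib mult.commute)
  ultimately show ?thesis by (simp add: quad_bdry_def)
qed

lemma quad_diff_Suc_n:
  "quad_diff a (Suc n) r = quad_diff a n r + quad_bdry a n / of_nat (Suc n) ^ 2 * hstar 2 (Suc n) r"
proof -
  have "(fact (Suc n) :: rat) ^ 2 = fact n ^ 2 * of_nat (Suc n) ^ 2"
    by (simp only: fact_Suc power_mult_distrib mult.commute)
  then show ?thesis by (simp add: quad_diff_def quad_bdry_def)
qed

lemma quad_diff_0: "a ^ 2 * quad_diff a n 0 = 1 - quad_bdry a n"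
proof (induction n)
  case (Suc n)
  define N :: rat where "N = of_nat (Suc n) ^ 2"
  define c where "c = quad_bdry a n / N"
  have "quad_bdry a n = c * N" by (simp add: c_def N_def)
  moreover have "quad_bdry a (Suc n) = c * (N - a ^ 2)" by (simp add: quad_bdry_Suc c_def N_def)
  moreover have "quad_diff a (Suc n) 0 = quad_diff a n 0 + c"
    by (simp add: quad_diff_Suc_n c_def N_def hstar_0)
  ultimately show ?case using Suc by (simp add: algebra_simps)
qed (simp add: quad_diff_def quad_bdry_def)

text \<open>Summation by parts again: from k - 1 to k, \<open>quad_bdry\<close> changes by - a^2
  times the k-th coefficient of \<open>quad_diff\<close>.\<close>

lemma quad_diff_Suc:
  "a ^ 2 * quad_diff a n (Suc r) - quad_diff a n r = - quad_bdry a n * hstar 2 n (Suc r)"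
proof (induction n)
  case (Suc n)
  define N :: rat where "N = of_nat (Suc n) ^ 2"
  define c where "c = quad_bdry a n / N"
  define g where "g = hstar 2 (Suc n) r / N"
  have "quad_bdry a n = c * N" by (simp add: c_def N_def)
  moreover have "quad_bdry a (Suc n) = c * N - c * a ^ 2"
    by (simp add: quad_bdry_Suc c_def N_def diff_divide_distrib right_diff_distrib)
  moreover have "hstar 2 (Suc n) r = g * N" by (simp add: g_def N_def)
  moreover have "hstar 2 (Suc n) (Suc r) = hstar 2 n (Suc r) + g"
    using hstar_Suc_Suc[of 2 n r] by (simp add: g_def N_def)
  moreover have "quad_diff a (Suc n) s = quad_diff a n s + c * hstar 2 (Suc n) s" for s
    by (simp add: quad_diff_Suc_n c_def N_def)
  ultimately have "a ^ 2 * quad_diff a (Suc n) (Suc r) - quad_diff a (Suc n) r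
        + quad_bdry a (Suc n) * hstar 2 (Suc n) (Suc r)
      = a ^ 2 * quad_diff a n (Suc r) - quad_diff a n r + quad_bdry a n * hstar 2 n (Suc r)"
    by (simp only:) (simp add: algebra_simps)
  with Suc show ?case by simp
qed (simp add: quad_diff_def hstar_Suc_0)

text \<open>Once the common Pochhammer factors are taken out, what remains is - a (a + k) - a (k -
  a) = - 2 a k, and the k cancels the denominator.\<close>

lemma quad_sum_diff: "quad_sum (a + 1) n r - quad_sum a n r = - 2 * a * quad_diff a n r"
proof -
  have "pochhammer (a + 1) k * pochhammer (1 - (a + 1)) k / fact k ^ 2 / of_nat k
        - pochhammer a k * pochhammer (1 - a) k / fact k ^ 2 / of_nat k
      = - 2 * a * (pochhammer (a + 1) (k - 1) * pochhammer (1 - a) (k - 1) / fact k ^ 2)"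
    if "k \<in> {1..n}" for k
  proof -
    from that obtain j where k: "k = Suc j" by (cases k) auto
    have "pochhammer (a + 1) k * pochhammer (1 - (a + 1)) k - pochhammer a k * pochhammer (1 - a) k
        = of_nat k * (- 2 * a * (pochhammer (a + 1) (k - 1) * pochhammer (1 - a) (k - 1)))"
    proof -
      have "pochhammer (1 - (a + 1)) k = - a * pochhammer (1 - a) j"
        using pochhammer_rec[of "-a" j] by (simp add: k)
      moreover have "pochhammer (a + 1) k = pochhammer (a + 1) j * (a + 1 + of_nat j)"
        "pochhammer (1 - a) k = pochhammer (1 - a) j * (1 - a + of_nat j)"
        unfolding k by (rule pochhammer_Suc)+
      moreover have "pochhammer a k = a * pochhammer (a + 1) j"
        unfolding k by (rule pochhammer_rec)
      ultimately show ?thesis by (simp only:) (simp add: k algebra_simps)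
    qed
    moreover have "(of_nat k :: rat) \<noteq> 0" using that by simp
    ultimately show ?thesis unfolding diff_divide_distrib[symmetric] by simp
  qed
  then show ?thesis
    unfolding quad_sum_def quad_diff_def sum_subtractf[symmetric] sum_distrib_left
    by (intro sum.cong refl) (simp only: left_diff_distrib[symmetric] mult.assoc[symmetric])
qed

lemma quad_diff_bdry_0:
  assumes "quad_bdry a n = 0"
  shows "a ^ (2 * r + 2) * quad_diff a n r = 1"
proof (induction r)
  case 0
  show ?case using quad_diff_0[of a n] assms by (simp add: power2_eq_square)
next
  case (Suc r)
  have "a ^ 2 * quad_diff a n (Suc r) = quad_diff a n r"
    using quad_diff_Suc[of a n r] assms by simp
  then have "a ^ (2 * r + 2) * (a ^ 2 * quad_diff a n (Suc r)) = 1" using Suc by simp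
  then show ?case by (simp add: power2_eq_square mult_ac)
qed

lemma quad_diff_of_nat:
  assumes "1 \<le> j" "j \<le> n"
  shows "quad_diff (of_nat j) n r = 1 / of_nat j ^ (2 * r + 2)"
proof -
  from assms obtain i where i: "j = Suc i" by (cases j) auto
  have "pochhammer (1 - of_nat j :: rat) n = 0"
    using pochhammer_of_nat_eq_0_lemma[of i n, where 'a = rat] assms by (simp add: i)
  then have "quad_bdry (of_nat j) n = 0" by (simp add: quad_bdry_def)
  from quad_diff_bdry_0[OF this, of r] show ?thesis
    using assms by (simp add: field_simps)
qed

lemma quad_sum_1: "quad_sum 1 n r = 0"
  by (auto simp: quad_sum_def pochhammer_0_left)

text \<open>The telescoping starts at a = 1, where (1 - a)_k is zero for k > 0. It goes no further
  than a = n + 1, because the boundary term no longer vanishes beyond a = n.\<close>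

lemma quad_sum_of_nat:
  assumes "j \<le> n"
  shows "quad_sum (of_nat j + 1) n r = - 2 * harm_pow (2 * r + 1) j"
  using assms
proof (induction j)
  case (Suc j)
  have "(of_nat (Suc j) :: rat) \<noteq> 0" by (metis of_nat_neq_0)
  with Suc quad_sum_diff[of "of_nat (Suc j)" n r] quad_diff_of_nat[of "Suc j" n r]
  show ?case by (simp add: harm_pow_def field_simps del: of_nat_Suc) (simp add: algebra_simps)
qed (simp add: quad_sum_1 harm_pow_def)

lemma central_binomial_pochhammer:
  "of_nat ((2 * k) choose k) = (4 ^ k * pochhammer (1 / 2) k / fact k :: rat)"
proof -
  have "of_nat ((2 * k) choose k) = (fact (2 * k) / (fact k * fact k) :: rat)"
    using binomial_fact[of k "2 * k", where 'a = rat] by (simp add: mult_2)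
  then show ?thesis by (simp add: fact_double power_mult)
qed

text \<open>Symmetry of the binomial coefficient binom(n + a - 1, a). For n = p the right-hand form
  exhibits the factors divisible by p.\<close>

lemma lin_bdry_of_nat:
  assumes "n > 0"
  shows "lin_bdry (of_nat a) (n - 1) = pochhammer (of_nat n) a / fact a"
proof -
  have "pochhammer 1 a * pochhammer (1 + of_nat a) (n - 1)
      = (pochhammer 1 (n - 1) * pochhammer (1 + of_nat (n - 1)) a :: rat)"
    unfolding pochhammer_product'[symmetric] by (simp only: add.commute)
  moreover have "1 + of_nat (n - 1) = (of_nat n :: rat)" using assms by simp
  ultimately have "fact a * pochhammer (of_nat a + 1) (n - 1) = (fact (n - 1) * pochhammer (of_nat n) a :: rat)"
    by (simp only: pochhammer_fact add.commute)
  then show ?thesis by (simp add: lin_bdry_def divide_simps mult.commute)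
qed

text \<open>For a = p + b and n = p - 1 the second argument is b, so both factors are binomial
  coefficients covered by \<open>lin_bdry_of_nat\<close>.\<close>

lemma quad_bdry_eq_lin_bdry:
  "quad_bdry a n = (- 1) ^ n * lin_bdry a n * lin_bdry (a - of_nat n - 1) n"
proof -
  have "pochhammer (1 - a) n = (- 1) ^ n * pochhammer (a - of_nat n) n"
    using pochhammer_minus[of "a - 1" n] by simp
  then show ?thesis by (simp add: quad_bdry_def lin_bdry_def power2_eq_square)
qed

section \<open>Rationals with denominator prime to p\<close>

text \<open>Sums and products of reduced fractions need not come out reduced; with arbitrary
  denominators prime to p the closure properties become immediate.\<close>

lemma p_integral_iff:
  assumes "prime p"
  shows "p_integral p x \<longleftrightarrow> (\<exists>a b. \<not> int p dvd b \<and> x = of_int a / of_int b)"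
proof
  assume *: "p_integral p x"
  obtain n d where q: "quotient_of x = (n, d)" by fastforce
  have "\<not> int p dvd d"
    using * q assms coprime_common_divisor[of "int p" d "int p"]
    by (auto simp: p_integral_def)
  with quotient_of_div[OF q] show "\<exists>a b. \<not> int p dvd b \<and> x = of_int a / of_int b" by blast
next
  assume "\<exists>a b. \<not> int p dvd b \<and> x = of_int a / of_int b"
  then obtain a b where ab: "\<not> int p dvd b" "x = of_int a / of_int b" by blast
  obtain n d where q: "quotient_of x = (n, d)" by fastforce
  have d: "d > 0" "coprime n d" "x = of_int n / of_int d"
    using quotient_of_denom_pos[OF q] quotient_of_coprime[OF q] quotient_of_div[OF q] by auto
  have "b \<noteq> 0" using ab(1) by auto
  have "(of_int (n * b) :: rat) = of_int (a * d)"
    using ab(2) d \<open>b \<noteq> 0\<close> by (simp add: field_simps)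
  then have eq: "n * b = a * d" by linarith
  have pp: "prime (int p)" using assms by simp
  have "\<not> int p dvd d"
  proof
    assume pd: "int p dvd d"
    then have "int p dvd n * b" unfolding eq by simp
    then have "int p dvd n" using pp ab(1) by (simp add: prime_dvd_mult_iff)
    with pd d(2) pp show False by (meson not_prime_unit coprime_common_divisor)
  qed
  then show "p_integral p x"
    using prime_imp_coprime[OF pp] q by (simp add: p_integral_def)
qed

locale localization =
  fixes p :: nat
  assumes prime_p: "prime p"
begin

abbreviation P :: rat where "P \<equiv> of_nat p"

definition Zp :: "rat set" where "Zp = {x. p_integral p x}"

definition pid :: "nat \<Rightarrow> rat set" where
  "pid e = (\<lambda>z. P ^ e * z) ` Zp"

text \<open>Unlike in \<open>rat_cong_pow\<close>, integrality of the two sides is not part of the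
  relation, so sums and differences need no side conditions. \<open>rcong_imp_rat_cong_pow\<close>
  recovers it from the right-hand side.\<close>

definition rcong :: "rat \<Rightarrow> nat \<Rightarrow> rat \<Rightarrow> bool"  (\<open>(_/ \<approx>[_]/ _)\<close> [51, 0, 51] 50) where
  "x \<approx>[e] y \<longleftrightarrow> x - y \<in> pid e"

lemma P_nz: "P \<noteq> 0"
  using prime_p by auto

lemma Zp_frac: "\<not> int p dvd b \<Longrightarrow> of_int a / of_int b \<in> Zp"
  unfolding Zp_def using p_integral_iff[OF prime_p] by blast

lemma Zp_cases:
  assumes "x \<in> Zp"
  obtains a b where "\<not> int p dvd b" "b \<noteq> 0" "x = of_int a / of_int b"
proof -
  obtain a b where "\<not> int p dvd b" "x = of_int a / of_int b"
    using assms p_integral_iff[OF prime_p, of x] by (auto simp: Zp_def)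
  moreover from this have "b \<noteq> 0" by auto
  ultimately show ?thesis using that by blast
qed

lemma Zp_of_int: "of_int a \<in> Zp"
  using Zp_frac[of 1 a] prime_gt_1_nat[OF prime_p] by simp

lemma Zp_of_nat: "of_nat a \<in> Zp"
  using Zp_of_int[of "int a"] by simp

lemma Zp_0: "0 \<in> Zp" and Zp_1: "1 \<in> Zp" and Zp_numeral: "numeral w \<in> Zp"
  using Zp_of_nat[of 0] Zp_of_nat[of 1] Zp_of_nat[of "numeral w"] by simp_all

lemma Zp_add: "x \<in> Zp \<Longrightarrow> y \<in> Zp \<Longrightarrow> x + y \<in> Zp"
proof -
  assume "x \<in> Zp" "y \<in> Zp"
  then obtain a b c d where *: "\<not> int p dvd b" "b \<noteq> 0" "x = of_int a / of_int b"
    "\<not> int p dvd d" "d \<noteq> 0" "y = of_int c / of_int d"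
    by (metis Zp_cases)
  have "x + y = of_int (a * d + c * b) / of_int (b * d)"
    using * by (simp add: field_simps)
  moreover have "\<not> int p dvd b * d" using * prime_p by (simp add: prime_dvd_mult_iff)
  ultimately show ?thesis using Zp_frac by metis
qed

lemma Zp_mult: "x \<in> Zp \<Longrightarrow> y \<in> Zp \<Longrightarrow> x * y \<in> Zp"
proof -
  assume "x \<in> Zp" "y \<in> Zp"
  then obtain a b c d where *: "\<not> int p dvd b" "b \<noteq> 0" "x = of_int a / of_int b"
    "\<not> int p dvd d" "d \<noteq> 0" "y = of_int c / of_int d"
    by (metis Zp_cases)
  have "x * y = of_int (a * c) / of_int (b * d)"
    using * by (simp add: field_simps)
  moreover have "\<not> int p dvd b * d" using * prime_p by (simp add: prime_dvd_mult_iff)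
  ultimately show ?thesis using Zp_frac by metis
qed

lemma Zp_minus: "x \<in> Zp \<Longrightarrow> - x \<in> Zp"
  using Zp_mult[OF Zp_of_int[of "-1"], of x] by simp

lemma Zp_diff: "x \<in> Zp \<Longrightarrow> y \<in> Zp \<Longrightarrow> x - y \<in> Zp"
  using Zp_add[of x "- y"] Zp_minus[of y] by simp

lemma Zp_power: "x \<in> Zp \<Longrightarrow> x ^ n \<in> Zp"
  by (induction n) (auto intro: Zp_1 Zp_mult)

lemma Zp_sum: "(\<And>i. i \<in> A \<Longrightarrow> f i \<in> Zp) \<Longrightarrow> sum f A \<in> Zp"
  by (induction A rule: infinite_finite_induct) (auto intro: Zp_0 Zp_add)

lemma Zp_prod: "(\<And>i. i \<in> A \<Longrightarrow> f i \<in> Zp) \<Longrightarrow> prod f A \<in> Zp"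
  by (induction A rule: infinite_finite_induct) (auto intro: Zp_1 Zp_mult)

lemma Zp_inverse_of_nat: "\<not> p dvd n \<Longrightarrow> 1 / of_nat n \<in> Zp"
  using Zp_frac[of "int n" 1] by simp

lemma Zp_divide: "x \<in> Zp \<Longrightarrow> 1 / y \<in> Zp \<Longrightarrow> x / y \<in> Zp"
  using Zp_mult[of x "1 / y"] by simp

lemma Zp_inverse_power: "1 / y \<in> Zp \<Longrightarrow> 1 / y ^ n \<in> Zp"
  using Zp_power[of "1 / y" n] by (simp add: power_divide)

lemma Zp_inverse_mult: "1 / x \<in> Zp \<Longrightarrow> 1 / y \<in> Zp \<Longrightarrow> 1 / (x * y) \<in> Zp"
  using Zp_mult[of "1 / x" "1 / y"] by simp

lemma pid_0: "pid 0 = Zp"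
  by (auto simp: pid_def)

lemma pid_iff: "x \<in> pid e \<longleftrightarrow> x / P ^ e \<in> Zp"
  using P_nz by (auto simp: pid_def intro: image_eqI[where x = "x / P ^ e"])

lemma pid_zero: "0 \<in> pid e"
  using Zp_0 by (simp add: pid_iff)

lemma pid_add: "x \<in> pid e \<Longrightarrow> y \<in> pid e \<Longrightarrow> x + y \<in> pid e"
  using Zp_add by (simp add: pid_iff add_divide_distrib)

lemma pid_minus: "x \<in> pid e \<Longrightarrow> - x \<in> pid e"
  using Zp_minus[of "x / P ^ e"] by (simp add: pid_iff)

lemma pid_diff: "x \<in> pid e \<Longrightarrow> y \<in> pid e \<Longrightarrow> x - y \<in> pid e"
  using pid_add[of x e "- y"] pid_minus by simp

lemma pid_mult: "x \<in> pid d \<Longrightarrow> y \<in> pid e \<Longrightarrow> x * y \<in> pid (d + e)"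
  using Zp_mult[of "x / P ^ d" "y / P ^ e"] by (simp add: pid_iff power_add)

lemma pid_mult_Zp: "x \<in> pid e \<Longrightarrow> y \<in> Zp \<Longrightarrow> x * y \<in> pid e"
  using pid_mult[of x e y 0] pid_0 by simp

lemma pid_Zp_mult: "x \<in> Zp \<Longrightarrow> y \<in> pid e \<Longrightarrow> x * y \<in> pid e"
  using pid_mult_Zp[of y e x] by (simp add: mult.commute)

lemma pid_sum: "(\<And>i. i \<in> A \<Longrightarrow> f i \<in> pid e) \<Longrightarrow> sum f A \<in> pid e"
  by (induction A rule: infinite_finite_induct) (auto intro: pid_zero pid_add)

lemma pid_power: "P ^ e \<in> pid e"
  using P_nz Zp_1 by (simp add: pid_iff)

lemma pid_mono: "x \<in> pid e \<Longrightarrow> d \<le> e \<Longrightarrow> x \<in> pid d"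
proof -
  assume x: "x \<in> pid e" and "d \<le> e"
  then have "x / P ^ d = x / P ^ e * P ^ (e - d)"
    using P_nz by (simp add: power_diff)
  moreover have "x / P ^ e * P ^ (e - d) \<in> Zp"
    using x by (intro Zp_mult Zp_power Zp_of_nat) (simp add: pid_iff)
  ultimately show ?thesis by (simp add: pid_iff)
qed

lemma pid_imp_Zp: "x \<in> pid e \<Longrightarrow> x \<in> Zp"
  using pid_mono[of x e 0] pid_0 by simp

lemma pid_cancel: "u * x \<in> pid e \<Longrightarrow> 1 / u \<in> Zp \<Longrightarrow> u \<noteq> 0 \<Longrightarrow> x \<in> pid e"
  using pid_mult_Zp[of "u * x" e "1 / u"] by simp

lemma pid_P_cancel: "P ^ d * x \<in> pid (d + e) \<longleftrightarrow> x \<in> pid e"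
  using P_nz by (simp add: pid_iff power_add)

lemma rcong_refl: "x \<approx>[e] x"
  by (simp add: rcong_def pid_zero)

lemma rcong_sym: "x \<approx>[e] y \<Longrightarrow> y \<approx>[e] x"
  using pid_minus by (fastforce simp: rcong_def)

lemma rcong_trans [trans]: "x \<approx>[e] y \<Longrightarrow> y \<approx>[e] z \<Longrightarrow> x \<approx>[e] z"
  using pid_add[of "x - y" e "y - z"] by (simp add: rcong_def)

lemma rcong_eq_trans [trans]: "x \<approx>[e] y \<Longrightarrow> y = z \<Longrightarrow> x \<approx>[e] z"
  and eq_rcong_trans [trans]: "x = y \<Longrightarrow> y \<approx>[e] z \<Longrightarrow> x \<approx>[e] z"
  by simp_all

lemma rcong_add: "x \<approx>[e] y \<Longrightarrow> x' \<approx>[e] y' \<Longrightarrow> x + x' \<approx>[e] y + y'"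
  using pid_add[of "x - y" e "x' - y'"] by (simp add: rcong_def algebra_simps)

lemma rcong_diff: "x \<approx>[e] y \<Longrightarrow> x' \<approx>[e] y' \<Longrightarrow> x - x' \<approx>[e] y - y'"
  using pid_diff[of "x - y" e "x' - y'"] by (simp add: rcong_def algebra_simps)

lemma rcong_minus: "x \<approx>[e] y \<Longrightarrow> - x \<approx>[e] - y"
  using pid_minus[of "x - y" e] by (simp add: rcong_def)

lemma rcong_sum: "(\<And>i. i \<in> A \<Longrightarrow> f i \<approx>[e] g i) \<Longrightarrow> sum f A \<approx>[e] sum g A"
  using pid_sum[of A "\<lambda>i. f i - g i" e] by (simp add: rcong_def sum_subtractf)

lemma rcong_mult_pid: "c \<in> pid d \<Longrightarrow> x \<approx>[e] y \<Longrightarrow> c * x \<approx>[d + e] c * y"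
  using pid_mult[of c d "x - y" e] by (simp add: rcong_def algebra_simps)

lemma rcong_mult_left: "c \<in> Zp \<Longrightarrow> x \<approx>[e] y \<Longrightarrow> c * x \<approx>[e] c * y"
  using rcong_mult_pid[of c 0 x e y] pid_0 by simp

lemma rcong_mult:
  assumes "x \<approx>[e] y" "x' \<approx>[e] y'" "x' \<in> Zp" "y \<in> Zp"
  shows "x * x' \<approx>[e] y * y'"
  using rcong_mult_left[OF assms(3,1)] rcong_mult_left[OF assms(4,2)]
    rcong_trans by (simp add: mult.commute)

lemma rcong_cancel: "u * x \<approx>[e] u * y \<Longrightarrow> 1 / u \<in> Zp \<Longrightarrow> u \<noteq> 0 \<Longrightarrow> x \<approx>[e] y"
  using pid_cancel[of u "x - y" e] by (simp add: rcong_def algebra_simps)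

lemma rcong_mono: "x \<approx>[e] y \<Longrightarrow> d \<le> e \<Longrightarrow> x \<approx>[d] y"
  using pid_mono by (auto simp: rcong_def)

lemma rcong_0: "x \<approx>[e] 0 \<longleftrightarrow> x \<in> pid e"
  by (simp add: rcong_def)

lemma rcong_P_cancel: "P ^ d * x \<approx>[d + e] P ^ d * y \<longleftrightarrow> x \<approx>[e] y"
  using pid_P_cancel[of d "x - y" e] by (simp add: rcong_def algebra_simps)

lemma rcong_pid: "x \<approx>[e] y \<Longrightarrow> y \<in> pid d \<Longrightarrow> d \<le> e \<Longrightarrow> x \<in> pid d"
  using pid_add[of "x - y" d y] pid_mono[of "x - y" e d] by (simp add: rcong_def)

lemma rcong_Zp: "x \<approx>[e] y \<Longrightarrow> y \<in> Zp \<Longrightarrow> x \<in> Zp"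
  using rcong_pid[of x e y 0] pid_0 by simp

lemma rcong_imp_rat_cong_pow:
  "x \<approx>[e] y \<Longrightarrow> y \<in> Zp \<Longrightarrow> rat_cong_pow p e x y"
  using rcong_Zp[of x e y] by (auto simp: rat_cong_pow_def rcong_def pid_def Zp_def)

text \<open>The localization is a local ring with maximal ideal \<open>pid 1\<close>. This is what
  later permits cancelling a factor known only to be nonzero modulo p.\<close>

lemma Zp_unit:
  assumes "x \<in> Zp" "x \<notin> pid 1"
  shows "1 / x \<in> Zp" "x \<noteq> 0"
proof -
  obtain a b where ab: "\<not> int p dvd b" "b \<noteq> 0" "x = of_int a / of_int b"
    using Zp_cases assms by metis
  have "\<not> int p dvd a"
  proof
    assume "int p dvd a"
    then obtain c where "a = int p * c" by blast
    then have "x = P ^ 1 * (of_int c / of_int b)" using ab by simp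
    then show False using assms(2) Zp_frac[OF ab(1)] unfolding pid_def by blast
  qed
  then show "1 / x \<in> Zp" using Zp_frac[of a b] ab by simp
  show "x \<noteq> 0" using assms(2) pid_zero by blast
qed

section \<open>Harmonic sums and Bernoulli numbers\<close>

lemma P_pid: "P \<in> pid 1"
  using pid_power[of 1] by simp

lemma p_gt_1: "p > 1"
  using prime_p by (rule prime_gt_1_nat)

lemma Zp_inverse_less: "0 < j \<Longrightarrow> j < p \<Longrightarrow> 1 / of_nat j \<in> Zp"
  by (intro Zp_inverse_of_nat) (auto dest: dvd_imp_le)

lemma harm_pow_Zp: "n < p \<Longrightarrow> harm_pow t n \<in> Zp"
  unfolding harm_pow_def by (intro Zp_sum Zp_inverse_power Zp_inverse_less) auto

lemma hstar_Zp: "n < p \<Longrightarrow> hstar t n r \<in> Zp"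
proof (induction r arbitrary: n)
  case 0
  show ?case by (simp add: hstar_0 Zp_1)
next
  case (Suc r)
  note outer = Suc.IH
  show ?case using Suc.prems
  proof (induction n)
    case 0
    show ?case by (simp add: hstar_Suc_0 Zp_0)
  next
    case (Suc n)
    have "hstar t (Suc n) r / of_nat (Suc n) ^ t \<in> Zp"
      using Suc.prems by (intro Zp_divide[OF outer Zp_inverse_power[OF Zp_inverse_less]]) auto
    with Suc show ?case unfolding hstar_Suc_Suc by (auto intro: Zp_add)
  qed
qed

section \<open>Power sums and Bernoulli numbers\<close>

definition power_sum :: "nat \<Rightarrow> rat" where
  "power_sum n = (\<Sum>j<p. of_nat j ^ n)"

text \<open>The differences (j + 1)^(n+1) - j^(n+1) telescope over j < p. The left-hand side has the
  shape of the recursion for \<open>bernoulli\<close>.\<close>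

lemma power_sum_recurrence: "(\<Sum>k\<le>n. of_nat (Suc n choose k) * power_sum k) = P ^ Suc n"
proof -
  have "(\<Sum>k\<le>n. of_nat (Suc n choose k) * power_sum k)
      = (\<Sum>j<p. \<Sum>k\<le>n. of_nat (Suc n choose k) * of_nat j ^ k)"
    unfolding power_sum_def sum_distrib_left by (rule sum.swap)
  also have "\<dots> = (\<Sum>j<p. of_nat (Suc j) ^ Suc n - of_nat j ^ Suc n)"
  proof (rule sum.cong)
    fix j
    have "(of_nat j + 1 :: rat) ^ Suc n = (\<Sum>k\<le>Suc n. of_nat (Suc n choose k) * of_nat j ^ k)"
      unfolding binomial_ring[of "of_nat j" 1] by simp
    then show "(\<Sum>k\<le>n. of_nat (Suc n choose k) * of_nat j ^ k :: rat)
        = of_nat (Suc j) ^ Suc n - of_nat j ^ Suc n"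
      by (simp add: add.commute)
  qed simp
  also have "\<dots> = P ^ Suc n"
    using sum_lessThan_telescope[of "\<lambda>j. of_nat j ^ Suc n :: rat" p] by simp
  finally show ?thesis .
qed

text \<open>For n > 0 the right-hand side p^(n+1) of \<open>power_sum_recurrence\<close> vanishes
  modulo p^2, so the power sums and p B_n obey the same recursion. Its leading coefficient n + 1 is
  a unit as n + 1 < p, which also gives the integrality of B_n.\<close>

lemma power_sum_cong_bernoulli:
  assumes "Suc n < p"
  shows "bernoulli n \<in> Zp \<and> power_sum n \<approx>[2] P * bernoulli n"
  using assms
proof (induction n rule: less_induct)
  case (less n)
  have unit: "1 / of_nat (Suc n) \<in> Zp" using less.prems by (intro Zp_inverse_less) auto
  show ?case
  proof (cases "n = 0")
    case True
    \<comment> \<open>The summand j = 0 counts here: 0^0 = 1 makes \<open>power_sum 0\<close> equal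
      to p exactly.\<close>
    then show ?thesis
      by (simp add: bernoulli.simps[of 0] power_sum_def Zp_1 rcong_refl)
  next
    case False
    let ?c = "\<lambda>k. of_nat (Suc n choose k) :: rat"
    have B: "bernoulli n = - (\<Sum>k<n. ?c k * bernoulli k) / of_nat (Suc n)"
      using False by (subst bernoulli.simps) simp
    have IH: "bernoulli k \<in> Zp" "power_sum k \<approx>[2] P * bernoulli k" if "k < n" for k
      using less.IH[of k] less.prems that by auto
    have Z: "bernoulli n \<in> Zp" unfolding B
      by (rule Zp_divide[OF _ unit]) (auto intro!: Zp_minus Zp_sum Zp_mult Zp_of_nat IH)
    have "of_nat (Suc n) * power_sum n = P ^ Suc n - (\<Sum>k<n. ?c k * power_sum k)"
      using power_sum_recurrence[of n] by (simp add: lessThan_Suc_atMost[symmetric])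
    also have "\<dots> \<approx>[2] 0 - (\<Sum>k<n. ?c k * (P * bernoulli k))"
    proof (intro rcong_diff rcong_sum rcong_mult_left Zp_of_nat IH)
      show "P ^ Suc n \<approx>[2] 0"
        unfolding rcong_0 using False by (intro pid_mono[OF pid_power]) simp
    qed auto
    also have "\<dots> = of_nat (Suc n) * (P * bernoulli n)"
    proof -
      have "of_nat (Suc n) * bernoulli n = - (\<Sum>k<n. ?c k * bernoulli k)"
        unfolding B by (simp del: of_nat_Suc)
      then have "of_nat (Suc n) * (P * bernoulli n) = P * - (\<Sum>k<n. ?c k * bernoulli k)"
        by (metis mult.left_commute)
      then show ?thesis by (simp add: sum_distrib_left mult_ac)
    qed
    finally have "power_sum n \<approx>[2] P * bernoulli n"
      by (rule rcong_cancel[OF _ unit of_nat_neq_0])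
    with Z show ?thesis by blast
  qed
qed

lemma power_sum_pid: "Suc n < p \<Longrightarrow> power_sum n \<in> pid 1"
proof -
  assume n: "Suc n < p"
  have "P * bernoulli n \<in> pid 1"
    using power_sum_cong_bernoulli[OF n] by (intro pid_mult_Zp P_pid) blast
  then show ?thesis using power_sum_cong_bernoulli[OF n] rcong_pid[of "power_sum n" 2 "P * bernoulli n" 1] by simp
qed

lemma power_sum_eq: "n > 0 \<Longrightarrow> power_sum n = (\<Sum>j=1..p-1. of_nat j ^ n)"
  unfolding power_sum_def using p_gt_1
  by (intro sum.mono_neutral_right) (auto simp: not_less)

lemma fermat: "0 < j \<Longrightarrow> j < p \<Longrightarrow> of_nat j ^ (p - 1) \<approx>[1] 1"
proof -
  assume j: "0 < j" "j < p"
  then have "\<not> p dvd j" by (auto dest: dvd_imp_le)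
  then have "[j ^ (p - 1) = 1] (mod p)" using prime_p fermat_theorem by blast
  then have "[int (j ^ (p - 1)) = int 1] (mod int p)" by (simp only: cong_int_iff)
  then obtain k where "int (j ^ (p - 1)) - 1 = int p * k" by (auto simp: cong_iff_dvd_diff dvd_def)
  then have "of_int (int (j ^ (p - 1)) - 1) = (of_int (int p * k) :: rat)" by (rule arg_cong)
  then have "of_nat j ^ (p - 1) - 1 = P * of_int k" by simp
  then show "of_nat j ^ (p - 1) \<approx>[1] 1"
    using pid_mult_Zp[OF pid_power[of 1] Zp_of_int[of k]] by (simp add: rcong_def)
qed

lemma inverse_power_cong:
  assumes "0 < j" "j < p" "s + t = p - 1"
  shows "1 / of_nat j ^ s \<approx>[1] of_nat j ^ t"
proof -
  have u: "1 / of_nat j \<in> Zp" and nz: "(of_nat j :: rat) \<noteq> 0" using assms Zp_inverse_less by auto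
  have "1 / of_nat j ^ s * (of_nat j ^ (p - 1)) \<approx>[1] 1 / of_nat j ^ s * 1"
    using assms u by (intro rcong_mult_left Zp_inverse_power fermat) auto
  moreover have "(of_nat j :: rat) ^ (p - 1) = of_nat j ^ s * of_nat j ^ t"
    by (simp only: assms(3)[symmetric] power_add)
  ultimately have "of_nat j ^ t \<approx>[1] 1 / of_nat j ^ s" using nz by simp
  then show ?thesis by (rule rcong_sym)
qed

lemma harm_pow_cong_power_sum:
  assumes "t + 1 < p"
  shows "harm_pow t (p - 1) \<approx>[1] power_sum (p - 1 - t)"
proof -
  have "1 / of_nat j ^ t \<approx>[1] of_nat j ^ (p - 1 - t)" if "j \<in> {1..p-1}" for j
    using that assms by (intro inverse_power_cong) (simp_all, linarith)
  moreover have "power_sum (p - 1 - t) = (\<Sum>j=1..p-1. of_nat j ^ (p - 1 - t))"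
    using assms by (intro power_sum_eq) linarith
  ultimately show ?thesis unfolding harm_pow_def by (simp only: rcong_sum)
qed

lemma harm_pow_pid: "1 \<le> t \<Longrightarrow> t + 1 < p \<Longrightarrow> harm_pow t (p - 1) \<in> pid 1"
  using rcong_pid[OF harm_pow_cong_power_sum power_sum_pid] by simp

section \<open>Expansion of inverse powers in a p-adically small shift\<close>

lemma inverse_power_expand:
  assumes b: "1 / b \<in> Zp" "b \<noteq> 0" and bu: "1 / (b + u) \<in> Zp" "b + u \<noteq> 0" and u: "u \<in> pid e"
  shows "1 / (b + u) ^ t \<approx>[3 * e]
    1 / b ^ t - of_nat t * u / b ^ Suc t + of_nat (Suc t choose 2) * u ^ 2 / b ^ Suc (Suc t)"
proof -
  define y z v where "y = 1 / b" and "z = 1 / (b + u)" and "v = u / b"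
  have Z: "y \<in> Zp" "z \<in> Zp" using b bu by (simp_all add: y_def z_def)
  have v: "v \<in> pid e" using pid_mult_Zp[OF u b(1)] by (simp add: v_def)
  have vZ: "v \<in> Zp" using v by (rule pid_imp_Zp)
  have v3: "v ^ 3 \<in> pid (3 * e)"
  proof -
    have "v * v * v \<in> pid (e + e + e)" by (intro pid_mult v)
    moreover have "e + e + e = 3 * e" by simp
    ultimately show ?thesis by (simp only: power3_eq_cube)
  qed
  have "(b + u) * y = 1 + v" using b by (simp add: y_def v_def add_divide_distrib)
  moreover have "z * ((b + u) * y) = y" using bu by (simp add: z_def)
  ultimately have rec: "z = y - v * z" by (simp add: algebra_simps)
  \<comment> \<open>Substituting \<open>rec\<close> into itself pushes the remainder to order
    v^3.\<close>
  have "z = y - v * (y - v * (y - v * z))" by (simp only: rec[symmetric])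
  then have "z - y * (1 - v + v ^ 2) = v ^ 3 * (- z)"
    by (simp add: algebra_simps power2_eq_square power3_eq_cube)
  then have z: "z \<approx>[3 * e] y * (1 - v + v ^ 2)"
    unfolding rcong_def using pid_mult_Zp[OF v3 Zp_minus[OF Z(2)]] by simp
  \<comment> \<open>These are the first coefficients of (1 + v)^(-t); binom(t + 1, 2) equals
    binom(-t, 2).\<close>
  have "z ^ t \<approx>[3 * e] y ^ t * (1 - of_nat t * v + of_nat (Suc t choose 2) * v ^ 2)"
  proof (induction t)
    case 0
    show ?case by (simp add: rcong_refl numeral_2_eq_2)
  next
    case (Suc t)
    define c :: rat where "c = of_nat (Suc t choose 2)"
    have c': "of_nat (Suc (Suc t) choose 2) = c + of_nat t + 1"
      by (simp add: c_def numeral_2_eq_2)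
    have "z ^ Suc t = z ^ t * z" by simp
    also have "\<dots> \<approx>[3 * e] (y ^ t * (1 - of_nat t * v + c * v ^ 2)) * (y * (1 - v + v ^ 2))"
      by (intro rcong_mult Suc[folded c_def] z)
         (auto simp: c_def intro!: Zp_mult Zp_add Zp_diff Zp_power Zp_of_nat Zp_1 Z vZ)
    also have "\<dots> \<approx>[3 * e] y ^ Suc t * (1 - of_nat (Suc t) * v + (c + of_nat t + 1) * v ^ 2)"
    proof -
      have "(y ^ t * (1 - of_nat t * v + c * v ^ 2)) * (y * (1 - v + v ^ 2))
          - y ^ Suc t * (1 - of_nat (Suc t) * v + (c + of_nat t + 1) * v ^ 2)
          = v ^ 3 * (y ^ Suc t * (c * v - c - of_nat t))"
        by (simp add: algebra_simps power2_eq_square power3_eq_cube)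
      also have "\<dots> \<in> pid (3 * e)"
        by (intro pid_mult_Zp v3)
           (auto simp: c_def intro!: Zp_mult Zp_diff Zp_power Zp_of_nat Z vZ)
      finally show ?thesis by (simp add: rcong_def)
    qed
    finally show ?case by (simp only: c')
  qed
  moreover have "z ^ t = 1 / (b + u) ^ t" "y ^ t = 1 / b ^ t"
    by (simp_all add: y_def z_def power_one_over)
  moreover have "of_nat t * u / b ^ Suc t = 1 / b ^ t * (of_nat t * v)"
    by (simp add: v_def)
  moreover have "of_nat (Suc t choose 2) * u ^ 2 / b ^ Suc (Suc t)
      = 1 / b ^ t * (of_nat (Suc t choose 2) * v ^ 2)"
    by (simp add: v_def power_divide power2_eq_square)
  ultimately show ?thesis by (simp only: distrib_left right_diff_distrib mult_1_right)
qed

lemma inverse_power_expand1: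
  assumes "1 / b \<in> Zp" "b \<noteq> 0" "1 / (b + u) \<in> Zp" "b + u \<noteq> 0" "u \<in> pid e"
  shows "1 / (b + u) ^ t \<approx>[2 * e] 1 / b ^ t - of_nat t * u / b ^ Suc t"
proof -
  have "u ^ 2 * (of_nat (Suc t choose 2) * (1 / b ^ Suc (Suc t))) \<in> pid (e + e)"
    by (rule pid_mult_Zp, simp only: power2_eq_square, rule pid_mult[OF assms(5,5)])
       (intro Zp_mult Zp_of_nat Zp_inverse_power assms(1))
  then have "of_nat (Suc t choose 2) * u ^ 2 / b ^ Suc (Suc t) \<approx>[2 * e] 0"
    unfolding rcong_0 mult_2 by (simp add: mult_ac)
  from rcong_add[OF rcong_refl this]
  have "1 / b ^ t - of_nat t * u / b ^ Suc t + of_nat (Suc t choose 2) * u ^ 2 / b ^ Suc (Suc t)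
     \<approx>[2 * e] 1 / b ^ t - of_nat t * u / b ^ Suc t"
    by simp
  moreover have "1 / (b + u) ^ t \<approx>[2 * e]
    1 / b ^ t - of_nat t * u / b ^ Suc t + of_nat (Suc t choose 2) * u ^ 2 / b ^ Suc (Suc t)"
    by (rule rcong_mono[OF inverse_power_expand[OF assms]]) simp
  ultimately show ?thesis by (rule rcong_trans[rotated])
qed

lemma inverse_power_reflect:
  assumes "0 < b" "b < p"
  shows "1 / of_nat (p - b) ^ t \<approx>[2] (- 1) ^ t * (1 / of_nat b ^ t + of_nat t * P / of_nat b ^ Suc t)"
proof -
  have sub: "of_nat (p - b) = P - of_nat b" using assms by (simp add: of_nat_diff)
  have "1 / (of_nat b + - P) \<in> Zp"
    using Zp_minus[OF Zp_inverse_less[of "p - b"]] assms unfolding sub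
    by (simp add: minus_divide_right)
  moreover have "of_nat b + - P \<noteq> (0 :: rat)" using assms by simp
  ultimately have "1 / (of_nat b + - P) ^ t \<approx>[2 * 1] 1 / of_nat b ^ t - of_nat t * (- P) / of_nat b ^ Suc t"
    using assms by (intro inverse_power_expand1 Zp_inverse_less pid_minus P_pid) auto
  from rcong_mult_left[OF Zp_power[OF Zp_minus[OF Zp_1]] this, of t]
  have "(- 1) ^ t * (1 / (of_nat b + - P) ^ t) \<approx>[2] (- 1) ^ t * (1 / of_nat b ^ t + of_nat t * P / of_nat b ^ Suc t)"
    by simp
  moreover have "(- 1) ^ t * (1 / (of_nat b + - P) ^ t) = 1 / of_nat (p - b) ^ t"
  proof -
    have "of_nat b + - P = - (P - of_nat b)" by simp
    then have "(of_nat b + - P) ^ t = (- 1) ^ t * (P - of_nat b) ^ t"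
      by (simp only: power_minus[of "P - of_nat b"])
    moreover have "(- 1) ^ t * (1 / ((- 1) ^ t * x)) = 1 / x" for x :: rat
      by (cases "even t") simp_all
    ultimately show ?thesis unfolding sub by (simp only:)
  qed
  ultimately show ?thesis by simp
qed

text \<open>For odd t the second term is - 1/(b - p)^t, so the sum is a difference of expansions
  with shifts p and - p. The terms of order 0 and 2 cancel, and the first-order term alone is
  correct modulo p^3.\<close>

lemma inverse_power_odd_pair:
  assumes "0 < b" "b < p" "odd t"
  shows "1 / of_nat (p + b) ^ t + 1 / of_nat (p - b) ^ t \<approx>[3] - 2 * of_nat t * P / of_nat b ^ Suc t"
proof -
  have sub: "of_nat (p - b) = P - of_nat b" using assms by (simp add: of_nat_diff)
  have ub: "1 / of_nat b \<in> Zp" using assms by (intro Zp_inverse_less) auto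
  have u1: "1 / (of_nat b + P) \<in> Zp"
  proof -
    have "\<not> p dvd b" using assms by (auto dest: dvd_imp_le)
    then show ?thesis using Zp_inverse_of_nat[of "b + p"] by simp
  qed
  have u2: "1 / (of_nat b + - P) \<in> Zp"
    using Zp_minus[OF Zp_inverse_less[of "p - b"]] assms unfolding sub
    by (simp add: minus_divide_right)
  have nz: "of_nat b + - P \<noteq> (0 :: rat)" "of_nat b + P \<noteq> 0" "of_nat b \<noteq> (0 :: rat)"
    using assms by (simp_all flip: of_nat_add)
  have "1 / (of_nat b + P) ^ t - 1 / (of_nat b + - P) ^ t \<approx>[3 * 1]
     (1 / of_nat b ^ t - of_nat t * P / of_nat b ^ Suc t + of_nat (Suc t choose 2) * P ^ 2 / of_nat b ^ Suc (Suc t))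
   - (1 / of_nat b ^ t - of_nat t * (- P) / of_nat b ^ Suc t + of_nat (Suc t choose 2) * (- P) ^ 2 / of_nat b ^ Suc (Suc t))"
    by (intro rcong_diff inverse_power_expand ub u1 u2 nz pid_minus P_pid)
  also have "\<dots> = - 2 * of_nat t * P / of_nat b ^ Suc t"
    by (simp add: algebra_simps)
  also have "1 / (of_nat b + - P) ^ t = - (1 / (P - of_nat b) ^ t)"
    using power_minus_odd[OF assms(3), of "P - of_nat b"] by simp
  finally show ?thesis by (simp add: sub add.commute[of "of_nat b" P])
qed

end

section \<open>Folding sums over 1, ..., p - 1 to half their length\<close>

lemma sum_fold_half:
  fixes f :: "nat \<Rightarrow> rat"
  shows "(\<Sum>j=1..2*m. f j) = (\<Sum>b=1..m. f b + f (Suc (2 * m) - b))"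
proof -
  have "{1..2*m} = {1..m} \<union> {Suc m..2*m}" by auto
  then have "(\<Sum>j=1..2*m. f j) = (\<Sum>j=1..m. f j) + (\<Sum>j=Suc m..2*m. f j)"
    by (simp only:) (intro sum.union_disjoint; auto)
  also have "(\<Sum>j=Suc m..2*m. f j) = (\<Sum>b=1..m. f (Suc (2 * m) - b))"
    by (rule sum.reindex_bij_witness[where i = "\<lambda>b. Suc (2 * m) - b" and j = "\<lambda>b. Suc (2 * m) - b"]) auto
  finally show ?thesis by (simp add: sum.distrib)
qed

text \<open>The odd indices are written as 2 m + 1 - 2 b. With 2 m + 1 = p they become reflections
  of the even ones, to which \<open>inverse_power_reflect\<close> applies.\<close>

lemma sum_split_parity:
  fixes f :: "nat \<Rightarrow> rat"
  shows "(\<Sum>j=1..2*m. f j) = (\<Sum>b=1..m. f (2 * b) + f (Suc (2 * m) - 2 * b))"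
proof -
  have "(\<Sum>j=1..2*m. f j) = (\<Sum>b=1..m. f (2 * b)) + (\<Sum>b=1..m. f (2 * b - 1))"
    by (induction m) simp_all
  also have "(\<Sum>b=1..m. f (2 * b - 1)) = (\<Sum>b=1..m. f (Suc (2 * m) - 2 * b))"
    by (rule sum.reindex_bij_witness[where i = "\<lambda>b. Suc m - b" and j = "\<lambda>b. Suc m - b"])
       (auto simp: diff_mult_distrib2)
  finally show ?thesis by (simp add: sum.distrib)
qed

context localization
begin

abbreviation half :: nat where "half \<equiv> (p - 1) div 2"

lemma p_odd_eq: "p > 2 \<Longrightarrow> p = Suc (2 * half)" and p_minus_1_eq: "p > 2 \<Longrightarrow> p - 1 = 2 * half"
  using prime_odd_nat[OF prime_p] by (auto elim!: oddE)

lemma Suc_p_minus_1: "Suc (p - 1) = p"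
  using p_gt_1 by simp

lemma sum_fold_p:
  fixes f :: "nat \<Rightarrow> rat"
  assumes "p > 2"
  shows "(\<Sum>j=1..p-1. f j) = (\<Sum>b=1..half. f b + f (p - b))"
    and "(\<Sum>j=1..p-1. f j) = (\<Sum>b=1..half. f (2 * b) + f (p - 2 * b))"
  using sum_fold_half[of f half] sum_split_parity[of f half]
  by (simp_all only: p_minus_1_eq[OF assms, symmetric] Suc_p_minus_1)

lemma harm_pow_fold:
  assumes "p > 2" "even s"
  shows "harm_pow s (p - 1) \<approx>[2] 2 * harm_pow s half + of_nat s * P * harm_pow (s + 1) half"
proof -
  have "harm_pow s (p - 1) = (\<Sum>b=1..half. 1 / of_nat b ^ s + 1 / of_nat (p - b) ^ s)"
    unfolding harm_pow_def by (rule sum_fold_p(1)[OF assms(1)])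
  also have "\<dots> \<approx>[2] (\<Sum>b=1..half. 1 / of_nat b ^ s +
      (- 1) ^ s * (1 / of_nat b ^ s + of_nat s * P / of_nat b ^ Suc s))"
    by (intro rcong_sum rcong_add rcong_refl inverse_power_reflect) auto
  also have "\<dots> = 2 * harm_pow s half + of_nat s * P * harm_pow (s + 1) half"
    using assms(2) by (simp add: harm_pow_def sum.distrib sum_distrib_left)
  finally show ?thesis .
qed

lemma harm_pow_parity:
  assumes "p > 2" "even s"
  shows "2 ^ (s + 1) * harm_pow s (p - 1) \<approx>[2] 4 * harm_pow s half + of_nat s * P * harm_pow (s + 1) half"
proof -
  have "harm_pow s (p - 1) = (\<Sum>b=1..half. 1 / of_nat (2 * b) ^ s + 1 / of_nat (p - 2 * b) ^ s)"
    unfolding harm_pow_def by (rule sum_fold_p(2)[OF assms(1)])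
  also have "\<dots> \<approx>[2] (\<Sum>b=1..half. 1 / of_nat (2 * b) ^ s +
      (- 1) ^ s * (1 / of_nat (2 * b) ^ s + of_nat s * P / of_nat (2 * b) ^ Suc s))"
    using p_odd_eq[OF assms(1)]
    by (intro rcong_sum rcong_add rcong_refl inverse_power_reflect) auto
  finally have "2 ^ (s + 1) * harm_pow s (p - 1) \<approx>[2] 2 ^ (s + 1) * (\<Sum>b=1..half. 1 / of_nat (2 * b) ^ s +
      (- 1) ^ s * (1 / of_nat (2 * b) ^ s + of_nat s * P / of_nat (2 * b) ^ Suc s))"
    by (intro rcong_mult_left Zp_power Zp_numeral)
  also have "\<dots> = (\<Sum>b=1..half. 4 * (1 / of_nat b ^ s) + of_nat s * P * (1 / of_nat b ^ (s + 1)))"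
    unfolding sum_distrib_left using assms(2)
    by (intro sum.cong refl) (simp add: power_mult_distrib distrib_left)
  also have "\<dots> = 4 * harm_pow s half + of_nat s * P * harm_pow (s + 1) half"
    by (simp only: harm_pow_def sum.distrib sum_distrib_left)
  finally show ?thesis .
qed

text \<open>\<open>harm_pow_fold\<close> and \<open>harm_pow_parity\<close> are two linear relations
  between the same three sums. Subtracting twice the first from the second eliminates
  \<open>harm_pow s half\<close>.\<close>

lemma harm_pow_half_odd:
  assumes "p > 2" "even s"
  shows "(2 ^ (s + 1) - 2) * harm_pow s (p - 1) \<approx>[2] - (of_nat s * P * harm_pow (s + 1) half)"
  using rcong_diff[OF harm_pow_parity[OF assms] rcong_mult_left[OF Zp_numeral[of "num.Bit0 num.One"] harm_pow_fold[OF assms]]]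
  by (simp add: algebra_simps)

lemma harm_pow_reflect:
  "harm_pow t (p - 1) \<approx>[2] (- 1) ^ t * (harm_pow t (p - 1) + of_nat t * P * harm_pow (t + 1) (p - 1))"
proof -
  have "harm_pow t (p - 1) = (\<Sum>b=1..p-1. 1 / of_nat (p - b) ^ t)"
    unfolding harm_pow_def
    by (rule sum.reindex_bij_witness[where i = "\<lambda>b. p - b" and j = "\<lambda>b. p - b"]) auto
  also have "\<dots> \<approx>[2] (\<Sum>b=1..p-1. (- 1) ^ t * (1 / of_nat b ^ t + of_nat t * P / of_nat b ^ Suc t))"
    by (intro rcong_sum inverse_power_reflect) auto
  also have "\<dots> = (- 1) ^ t * (harm_pow t (p - 1) + of_nat t * P * harm_pow (t + 1) (p - 1))"
    by (simp add: harm_pow_def sum.distrib sum_distrib_left distrib_left)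
  finally show ?thesis .
qed

lemma half_unit: "p > 2 \<Longrightarrow> 1 / 2 \<in> Zp"
  using Zp_inverse_less[of 2] by simp

text \<open>A generalization of Wolstenholme's theorem: for odd t, reflection gives 2 H = - t p H'
  modulo p^2, where H' is the sum of order t + 1, again divisible by p.\<close>

lemma harm_pow_odd_pid:
  assumes "odd t" "t + 2 < p"
  shows "harm_pow t (p - 1) \<in> pid 2"
proof -
  have "P * harm_pow (t + 1) (p - 1) \<in> pid (1 + 1)"
    using assms by (intro pid_mult P_pid harm_pow_pid) auto
  then have 1: "of_nat t * (P * harm_pow (t + 1) (p - 1)) \<in> pid 2"
    unfolding one_add_one by (rule pid_Zp_mult[OF Zp_of_nat])
  have "harm_pow t (p - 1) - - (harm_pow t (p - 1) + of_nat t * P * harm_pow (t + 1) (p - 1)) \<in> pid 2"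
    using harm_pow_reflect[of t] assms(1) by (simp add: rcong_def)
  from pid_diff[OF this 1] have "2 * harm_pow t (p - 1) \<in> pid 2"
    by (simp add: mult.assoc)
  then show ?thesis by (rule pid_cancel) (use half_unit assms in auto)
qed

lemma harm_pow_half_even_pid:
  assumes "even s" "1 \<le> s" "s + 1 < p"
  shows "harm_pow s half \<in> pid 1"
proof -
  have p2: "p > 2" using assms by simp
  have "harm_pow s (p - 1) \<approx>[1] 2 * harm_pow s half + of_nat s * P * harm_pow (s + 1) half"
    by (rule rcong_mono[OF harm_pow_fold[OF p2 assms(1)]]) simp
  moreover have "P * (of_nat s * harm_pow (s + 1) half) \<in> pid 1"
    using p2 by (intro pid_mult_Zp Zp_mult Zp_of_nat harm_pow_Zp P_pid) auto
  moreover have "harm_pow s (p - 1) \<in> pid 1" using assms by (intro harm_pow_pid) auto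
  ultimately have "2 * harm_pow s half \<in> pid 1"
    using pid_diff[OF pid_diff, of "harm_pow s (p - 1)" 1 "P * (of_nat s * harm_pow (s + 1) half)"
        "harm_pow s (p - 1) - (2 * harm_pow s half + of_nat s * P * harm_pow (s + 1) half)"]
    by (simp add: rcong_def algebra_simps)
  then show ?thesis by (rule pid_cancel) (use half_unit p2 in auto)
qed

section \<open>A Kummer-type congruence for harmonic sums modulo p squared\<close>

lemma power_shift_cong:
  "(x + P * k) ^ n \<approx>[2] x ^ n + of_nat n * P * k * x ^ (n - 1)" if "x \<in> Zp" "k \<in> Zp"
proof (induction n)
  case 0
  show ?case by (simp add: rcong_refl)
next
  case (Suc n)
  have pk: "(P * k) \<in> pid 1" using that by (intro pid_mult_Zp P_pid)
  have "(x + P * k) ^ Suc n = (x + P * k) * (x + P * k) ^ n" by simp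
  also have "\<dots> \<approx>[2] (x + P * k) * (x ^ n + of_nat n * P * k * x ^ (n - 1))"
    by (intro rcong_mult_left Suc.IH Zp_add Zp_mult Zp_of_nat that)
  also have "\<dots> \<approx>[2] x ^ Suc n + of_nat (Suc n) * P * k * x ^ (Suc n - 1)"
  proof -
    have "(x + P * k) * (x ^ n + of_nat n * P * k * x ^ (n - 1))
      - (x ^ Suc n + of_nat (Suc n) * P * k * x ^ (Suc n - 1))
      = P * k * (P * k) * (of_nat n * x ^ (n - 1))"
      by (cases n) (simp_all add: algebra_simps)
    also have "\<dots> \<in> pid (1 + 1)"
      by (intro pid_mult_Zp[OF pid_mult] pk Zp_mult Zp_of_nat Zp_power that)
    finally show ?thesis by (simp only: rcong_def one_add_one)
  qed
  finally show ?case .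
qed

text \<open>Modulo \<open>p\<^sup>2\<close>, this combination depends only on \<open>x\<close> modulo \<open>p\<close> when \<open>n + t = p - 1\<close>:
  the first-order terms of the two summands cancel by Fermat's little theorem.\<close>

definition kummer :: "nat \<Rightarrow> nat \<Rightarrow> nat \<Rightarrow> rat" where
  "kummer n t x = of_nat n / of_nat x ^ t + of_nat t * of_nat x ^ n"

lemma kummer_cong:
  assumes nt: "n + t = p - 1" "n > 0" and y: "0 < y" "y < p"
  shows "kummer n t (y + p * k) \<approx>[2] kummer n t y"
proof -
  define x where "x = (of_nat y :: rat)"
  have x0: "x \<noteq> 0" using y by (simp add: x_def)
  have xZ: "x \<in> Zp" "1 / x \<in> Zp" using y by (auto simp: x_def Zp_of_nat intro: Zp_inverse_less)
  have "\<not> p dvd y" using y by (auto dest: dvd_imp_le)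
  then have "\<not> p dvd y + p * k" using dvd_add_left_iff[of p "p * k" y] by simp
  then have "1 / of_nat (y + p * k) \<in> Zp" by (rule Zp_inverse_of_nat)
  then have u: "1 / (x + P * of_nat k) \<in> Zp" by (simp add: x_def)
  have nz: "x + P * of_nat k \<noteq> 0"
    using y by (simp add: x_def flip: of_nat_mult of_nat_add)
  have "1 / (x + P * of_nat k) ^ t \<approx>[2 * 1] 1 / x ^ t - of_nat t * (P * of_nat k) / x ^ Suc t"
    by (intro inverse_power_expand1 xZ x0 u nz pid_mult_Zp P_pid Zp_of_nat)
  then have e1: "1 / (x + P * of_nat k) ^ t \<approx>[2] 1 / x ^ t - of_nat t * (P * of_nat k) / x ^ Suc t"
    by simp
  have e2: "(x + P * of_nat k) ^ n \<approx>[2] x ^ n + of_nat n * P * of_nat k * x ^ (n - 1)"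
    by (intro power_shift_cong xZ Zp_of_nat)
  have "kummer n t (y + p * k) = of_nat n * (1 / (x + P * of_nat k) ^ t) + of_nat t * (x + P * of_nat k) ^ n"
    by (simp add: kummer_def x_def)
  also have "\<dots> \<approx>[2] of_nat n * (1 / x ^ t - of_nat t * (P * of_nat k) / x ^ Suc t)
      + of_nat t * (x ^ n + of_nat n * P * of_nat k * x ^ (n - 1))"
    by (intro rcong_add rcong_mult_left Zp_of_nat e1 e2)
  also have "\<dots> \<approx>[2] kummer n t y"
  proof -
    have "x ^ (p - 1) = x ^ Suc t * x ^ (n - 1)"
      unfolding nt(1)[symmetric] power_add[symmetric] using nt(2) by (simp add: add.commute)
    then have "x ^ (n - 1) - 1 / x ^ Suc t = (x ^ (p - 1) - 1) * (1 / x ^ Suc t)"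
      using x0 by (simp add: diff_divide_distrib left_diff_distrib)
    also have "\<dots> \<in> pid 1"
      using fermat[OF y] by (intro pid_mult_Zp Zp_inverse_power xZ) (simp add: x_def rcong_def)
    finally have "P * (x ^ (n - 1) - 1 / x ^ Suc t) \<in> pid (1 + 1)" by (intro pid_mult P_pid)
    then have "P * (x ^ (n - 1) - 1 / x ^ Suc t) * (of_nat n * of_nat t * of_nat k) \<in> pid 2"
      unfolding one_add_one by (rule pid_mult_Zp) (intro Zp_mult Zp_of_nat)
    moreover have "of_nat n * (1 / x ^ t - of_nat t * (P * of_nat k) / x ^ Suc t)
      + of_nat t * (x ^ n + of_nat n * P * of_nat k * x ^ (n - 1)) - kummer n t y
      = P * (x ^ (n - 1) - 1 / x ^ Suc t) * (of_nat n * of_nat t * of_nat k)"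
      by (simp add: kummer_def x_def[symmetric] algebra_simps)
    ultimately show ?thesis by (simp only: rcong_def)
  qed
  finally show ?thesis .
qed

lemma bij_mult_mod:
  assumes "0 < c" "c < p"
  shows "bij_betw (\<lambda>j. c * j mod p) {1..p-1} {1..p-1}"
proof -
  have cop: "coprime c p"
    using assms prime_p by (metis coprime_commute nat_dvd_not_less prime_imp_coprime)
  have inj: "inj_on (\<lambda>j. c * j mod p) {1..p-1}"
  proof (rule inj_onI)
    fix i j assume *: "i \<in> {1..p-1}" "j \<in> {1..p-1}" "c * i mod p = c * j mod p"
    then have "[c * i = c * j] (mod p)" by (simp add: cong_def)
    then have "[i = j] (mod p)" using cop cong_mult_lcancel_nat by blast
    then show "i = j" using * p_gt_1 by (intro cong_less_imp_eq_nat) auto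
  qed
  have "c * j mod p \<in> {1..p-1}" if "j \<in> {1..p-1}" for j
  proof -
    have "\<not> p dvd j" using that by (auto dest: dvd_imp_le)
    then have "\<not> p dvd c * j" using cop prime_p by (metis coprime_commute coprime_dvd_mult_right_iff)
    then have "c * j mod p > 0" by (simp add: dvd_eq_mod_eq_0)
    moreover have "c * j mod p < p" using p_gt_1 by simp
    ultimately show ?thesis by simp
  qed
  then have "(\<lambda>j. c * j mod p) ` {1..p-1} \<subseteq> {1..p-1}" by auto
  with endo_inj_surj[OF _ this inj] inj show ?thesis by (simp add: bij_betw_def)
qed

lemma one_notin_pid: "1 \<notin> pid 1"
proof
  assume "1 \<in> pid 1"
  then obtain z where z: "z \<in> Zp" "1 = P * z" by (auto simp: pid_def)
  then obtain a b where ab: "\<not> int p dvd b" "b \<noteq> 0" "z = of_int a / of_int b"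
    using Zp_cases by metis
  then have "(of_int b :: rat) = P * z * of_int b" using z(2) by simp
  also have "\<dots> = of_int (int p * a)" using ab(2,3) by simp
  finally have "(of_int b :: rat) = of_int (int p * a)" .
  then have "b = int p * a" by linarith
  then show False using ab(1) by simp
qed

text \<open>A substitute for a primitive root. If every summand of \<open>harm_pow t (p - 1)\<close>
  were 1 modulo p, the sum would be p - 1 modulo p, whereas it is divisible by p.\<close>

lemma ex_power_not_cong_1:
  assumes "1 \<le> t" "t + 1 < p"
  shows "\<exists>c. 0 < c \<and> c < p \<and> 1 / of_nat c ^ t - 1 \<notin> pid 1"
proof (rule ccontr)
  assume "\<not> ?thesis"
  then have "1 / of_nat c ^ t \<approx>[1] 1" if "c \<in> {1..p-1}" for c
  proof -
    have "0 < c" "c < p" using that p_gt_1 by auto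
    with \<open>\<not> _\<close> show ?thesis unfolding rcong_def by blast
  qed
  then have "harm_pow t (p - 1) \<approx>[1] (\<Sum>c=1..p-1. 1)"
    unfolding harm_pow_def by (intro rcong_sum)
  then have "harm_pow t (p - 1) - (P - 1) \<in> pid 1"
    using p_gt_1 by (simp add: rcong_def of_nat_diff)
  from pid_add[OF pid_diff[OF this harm_pow_pid[OF assms]] P_pid] have "1 \<in> pid 1" by simp
  then show False using one_notin_pid by contradiction
qed

text \<open>Write S for the power sum and T = n H + t S for the sum of \<open>kummer\<close> over 1,
  ..., p - 1. Multiplication by c permutes the nonzero residues, which gives (c^(-t) - 1) T = 0
  modulo p^2. Choosing c so that the first factor is a unit forces T = 0, and S is p B_n modulo
  p^2.\<close>

lemma harm_pow_bernoulli:
  assumes "1 \<le> t" "t + 2 < p"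
  shows "of_nat (t + 1) * harm_pow t (p - 1) \<approx>[2] of_nat t * P * bernoulli (p - 1 - t)"
proof -
  define n where "n = p - 1 - t"
  define H where "H = harm_pow t (p - 1)"
  have nt: "n + t = p - 1" "n > 0" "Suc n < p" using assms by (auto simp: n_def)
  obtain c where c: "0 < c" "c < p" "1 / of_nat c ^ t - 1 \<notin> pid 1"
    using ex_power_not_cong_1[of t] assms by auto
  have uc: "1 / of_nat c \<in> Zp" using c Zp_inverse_less by blast
  have H1: "H \<in> pid 1" using assms harm_pow_pid[of t] by (simp add: H_def)
  have S1: "power_sum n \<in> pid 1" using nt power_sum_pid by simp
  have sum1: "(\<Sum>j=1..p-1. kummer n t j) = of_nat n * H + of_nat t * power_sum n"
    using nt by (simp add: kummer_def H_def harm_pow_def power_sum_eq sum.distrib sum_distrib_left)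
  have "of_nat n * (1 / of_nat c ^ t) * H + of_nat t * of_nat c ^ n * power_sum n
      = (\<Sum>j=1..p-1. kummer n t (c * j))"
    using nt by (simp add: kummer_def H_def harm_pow_def power_sum_eq sum.distrib sum_distrib_left
        power_mult_distrib mult_ac)
  also have "\<dots> \<approx>[2] (\<Sum>j=1..p-1. kummer n t (c * j mod p))"
  proof (rule rcong_sum)
    fix j assume j: "j \<in> {1..p-1}"
    have "c * j mod p \<in> {1..p-1}" using bij_betwE[OF bij_mult_mod[OF c(1,2)]] j by auto
    with kummer_cong[OF nt(1,2), of "c * j mod p" "c * j div p"]
    show "kummer n t (c * j) \<approx>[2] kummer n t (c * j mod p)" using p_gt_1 by simp
  qed
  also have "\<dots> = (\<Sum>j=1..p-1. kummer n t j)"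
    by (rule sum.reindex_bij_betw[OF bij_mult_mod[OF c(1,2)]])
  also note sum1
  finally have A: "of_nat n * (1 / of_nat c ^ t) * H + of_nat t * of_nat c ^ n * power_sum n
      \<approx>[2] of_nat n * H + of_nat t * power_sum n" .
  \<comment> \<open>A congruence modulo p suffices, since \<open>power_sum n\<close> supplies
    another factor p.\<close>
  have "of_nat c ^ n \<approx>[1] 1 / of_nat c ^ t"
    by (rule rcong_sym, rule inverse_power_cong[OF c(1,2)]) (use nt in simp)
  from rcong_mult_pid[OF S1 this]
  have "power_sum n * of_nat c ^ n \<approx>[2] power_sum n * (1 / of_nat c ^ t)"
    by (simp only: one_add_one)
  from rcong_mult_left[OF Zp_of_nat[of t] this]
  have B: "of_nat n * (1 / of_nat c ^ t) * H + of_nat t * of_nat c ^ n * power_sum n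
      \<approx>[2] of_nat n * (1 / of_nat c ^ t) * H + of_nat t * (power_sum n * (1 / of_nat c ^ t))"
    by (intro rcong_add rcong_refl) (simp add: mult_ac)
  have "(1 / of_nat c ^ t - 1) * (of_nat n * H + of_nat t * power_sum n) \<in> pid 2"
    using rcong_trans[OF rcong_sym[OF B] A] by (simp add: rcong_def algebra_simps)
  moreover have "1 / of_nat c ^ t - 1 \<in> Zp" using uc by (intro Zp_diff Zp_inverse_power Zp_1)
  note u = Zp_unit[OF this c(3)]
  ultimately have C: "of_nat n * H + of_nat t * power_sum n \<in> pid 2"
    using pid_cancel[OF _ u] by blast
  \<comment> \<open>As p H vanishes modulo p^2, the coefficient n = p - 1 - t of H may be replaced
    by - (t + 1).\<close>
  have "H * P \<in> pid (1 + 1)" using H1 P_pid by (rule pid_mult)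
  then have D: "H * P \<in> pid 2" by (simp only: one_add_one)
  have "of_nat t * power_sum n \<approx>[2] of_nat t * (P * bernoulli n)"
    using power_sum_cong_bernoulli nt(3) by (intro rcong_mult_left Zp_of_nat) blast
  then have E: "of_nat t * power_sum n - of_nat t * (P * bernoulli n) \<in> pid 2"
    by (simp only: rcong_def)
  have "of_nat n = P - 1 - of_nat t" using assms by (simp add: n_def of_nat_diff)
  with pid_add[OF pid_diff[OF D C] E]
  show ?thesis unfolding rcong_def H_def[symmetric] n_def[symmetric] by (simp add: algebra_simps)
qed

text \<open>In \<open>harm_pow_half_odd\<close> the half sum carries the factor s p. Cancelling it,
  with s a unit, costs one power of p.\<close>

lemma harm_pow_half_bernoulli:
  assumes "even s" "1 \<le> s" "s + 2 < p"
  shows "of_nat (s + 1) * harm_pow (s + 1) half \<approx>[1] - ((2 ^ (s + 1) - 2) * bernoulli (p - 1 - s))"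
proof -
  define M :: rat where "M = 2 ^ (s + 1) - 2"
  have MZ: "M \<in> Zp" unfolding M_def by (intro Zp_diff Zp_power Zp_numeral)
  have p2: "p > 2" using assms by simp
  have "of_nat (s + 1) * (M * harm_pow s (p - 1)) \<approx>[2]
      of_nat (s + 1) * - (of_nat s * P * harm_pow (s + 1) half)"
    unfolding M_def by (intro rcong_mult_left Zp_of_nat harm_pow_half_odd p2 assms)
  note 1 = rcong_sym[OF this]
  have "M * (of_nat (s + 1) * harm_pow s (p - 1)) \<approx>[2] M * (of_nat s * P * bernoulli (p - 1 - s))"
    using assms by (intro rcong_mult_left MZ harm_pow_bernoulli) auto
  then have "of_nat (s + 1) * (M * harm_pow s (p - 1)) \<approx>[2] M * (of_nat s * P * bernoulli (p - 1 - s))"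
    by (simp only: mult.left_commute)
  from rcong_trans[OF 1 this] have "of_nat (s + 1) * - (of_nat s * P * harm_pow (s + 1) half) \<approx>[2] M * (of_nat s * P * bernoulli (p - 1 - s))"
    .
  then have "of_nat s * (P ^ 1 * - (of_nat (s + 1) * harm_pow (s + 1) half)) \<approx>[1 + 1] of_nat s * (P ^ 1 * (M * bernoulli (p - 1 - s)))"
    unfolding one_add_one by (simp add: mult_ac)
  then have "P ^ 1 * - (of_nat (s + 1) * harm_pow (s + 1) half) \<approx>[1 + 1] P ^ 1 * (M * bernoulli (p - 1 - s))"
    by (rule rcong_cancel) (use assms in \<open>auto intro!: Zp_inverse_less\<close>)
  then have "- (of_nat (s + 1) * harm_pow (s + 1) half) \<approx>[1] M * bernoulli (p - 1 - s)"
    by (simp only: rcong_P_cancel)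
  from rcong_minus[OF this] show ?thesis by (simp add: M_def)
qed

section \<open>Star sums up to p - 1\<close>

lemma hstar_pid:
  assumes "t \<ge> 1" "r \<ge> 1" "t * r + 1 < p"
  shows "hstar t (p - 1) r \<in> pid 1"
  using assms(2,3)
proof (induction r rule: less_induct)
  case (less r)
  have "r \<le> t * r" using assms(1) by simp
  then have r: "r < p" using less.prems by linarith
  have "hstar t (p - 1) (r - i) * harm_pow (t * i) (p - 1) \<in> pid 1" if "i \<in> {1..r}" for i
  proof -
    have "t * i \<le> t * r" using that by simp
    moreover have "1 \<le> t * i" using that assms(1) by simp
    ultimately have "harm_pow (t * i) (p - 1) \<in> pid 1" using less.prems by (intro harm_pow_pid) linarith+
    then show ?thesis using p_gt_1 by (intro pid_Zp_mult hstar_Zp) auto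
  qed
  then have "of_nat r * hstar t (p - 1) r \<in> pid 1"
    unfolding hstar_newton by (rule pid_sum)
  then show ?case by (rule pid_cancel) (use less.prems r in \<open>auto intro: Zp_inverse_less\<close>)
qed

text \<open>In Newton's identity every summand with i < r is a product of two factors divisible by
  p; only i = r survives modulo p^2.\<close>

lemma hstar_cong_harm_pow:
  assumes "t \<ge> 1" "r \<ge> 1" "t * r + 1 < p"
  shows "of_nat r * hstar t (p - 1) r \<approx>[2] harm_pow (t * r) (p - 1)"
proof -
  obtain q where q: "r = Suc q" using assms(2) by (cases r) auto
  have "hstar t (p - 1) (r - i) * harm_pow (t * i) (p - 1) \<in> pid 2" if "i \<in> {1..q}" for i
  proof -
    have i: "1 \<le> i" "i < r" using that q by auto
    have "t * i \<le> t * r" "t * (r - i) \<le> t * r" using i by simp_all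
    moreover have "1 \<le> t * i" using i assms(1) by simp
    ultimately have "hstar t (p - 1) (r - i) * harm_pow (t * i) (p - 1) \<in> pid (1 + 1)"
      using assms i by (intro pid_mult hstar_pid harm_pow_pid) linarith+
    then show ?thesis by (simp only: one_add_one)
  qed
  then have "(\<Sum>i=1..q. hstar t (p - 1) (r - i) * harm_pow (t * i) (p - 1)) \<in> pid 2"
    by (rule pid_sum)
  then show ?thesis
    unfolding hstar_newton by (simp add: q hstar_0 rcong_def)
qed

section \<open>The linear sum modulo p squared\<close>

text \<open>The point is the order of quantifiers: Y does not depend on s, so values at several s
  can be combined to eliminate it.\<close>

lemma prod_perturb:
  fixes c :: "nat \<Rightarrow> rat"
  assumes c: "\<And>i. c i \<in> Zp" and v: "v \<in> pid e"
  shows "\<exists>Y\<in>Zp. \<forall>s\<in>Zp. (\<Prod>i<k. c i + s * v) \<approx>[2 * e] (\<Prod>i<k. c i) + s * v * Y"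
proof (induction k)
  case 0
  show ?case by (intro bexI[of _ 0]) (auto simp: rcong_refl Zp_0)
next
  case (Suc k)
  then obtain Y where Y: "Y \<in> Zp"
    "\<And>s. s \<in> Zp \<Longrightarrow> (\<Prod>i<k. c i + s * v) \<approx>[2 * e] (\<Prod>i<k. c i) + s * v * Y" by blast
  define A where "A = (\<Prod>i<k. c i)"
  have A: "A \<in> Zp" unfolding A_def using c by (intro Zp_prod)
  have vZ: "v \<in> Zp" using v by (rule pid_imp_Zp)
  show ?case
  proof (intro bexI[of _ "Y * c k + A"] ballI)
    show "Y * c k + A \<in> Zp" using c A Y(1) by (intro Zp_add Zp_mult)
    fix s assume s: "s \<in> Zp"
    have "(\<Prod>i<Suc k. c i + s * v) = (c k + s * v) * (\<Prod>i<k. c i + s * v)" by simp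
    also have "\<dots> \<approx>[2 * e] (c k + s * v) * (A + s * v * Y)"
      unfolding A_def using c s vZ by (intro rcong_mult_left Y Zp_add Zp_mult)
    also have "\<dots> \<approx>[2 * e] A * c k + s * v * (Y * c k + A)"
    proof -
      have "v * v * (s * s * Y) \<in> pid (e + e)"
        using v s Y(1) by (intro pid_mult_Zp pid_mult Zp_mult)
      then have "v * v * (s * s * Y) \<in> pid (2 * e)" by (simp only: mult_2)
      then show ?thesis by (simp add: rcong_def algebra_simps)
    qed
    finally show "(\<Prod>i<Suc k. c i + s * v) \<approx>[2 * e] (\<Prod>i<Suc k. c i) + s * v * (Y * c k + A)"
      by (simp add: A_def)
  qed
qed

lemma pochhammer_Zp: "x \<in> Zp \<Longrightarrow> pochhammer x k \<in> Zp"
  unfolding pochhammer_prod by (intro Zp_prod Zp_add Zp_of_nat)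

lemma pochhammer_cong:
  assumes "x \<approx>[e] y" "x \<in> Zp" "y \<in> Zp"
  shows "pochhammer x k \<approx>[e] pochhammer y k"
proof (induction k)
  case 0
  show ?case by (simp add: rcong_refl)
next
  case (Suc k)
  show ?case unfolding pochhammer_Suc
    by (intro rcong_mult Suc rcong_add rcong_refl Zp_add Zp_of_nat pochhammer_Zp assms)
qed

lemma inverse_fact_Zp: "k < p \<Longrightarrow> 1 / fact k \<in> Zp"
  using Zp_inverse_of_nat[of "fact k"] prime_dvd_fact_iff[OF prime_p, of k] by simp

lemma rcong_divide:
  assumes "x \<approx>[e] y" "u \<approx>[e] v" "1 / u \<in> Zp" "u \<noteq> 0" "1 / v \<in> Zp" "v \<noteq> 0" "v \<in> Zp" "y \<in> Zp"
  shows "x / u \<approx>[e] y / v"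
proof -
  have "((x - y) * v - (u - v) * y) * (1 / (u * v)) \<in> pid e"
    by (intro pid_mult_Zp[OF pid_diff[OF pid_mult_Zp pid_mult_Zp]] Zp_inverse_mult assms)
       (use assms in \<open>simp_all add: rcong_def\<close>)
  moreover have "((x - y) * v - (u - v) * y) * (1 / (u * v)) = x / u - y / v"
    using assms by (simp add: divide_simps) (simp add: algebra_simps)
  ultimately show ?thesis by (simp only: rcong_def)
qed

lemma rcong_unit:
  assumes "x \<approx>[1] y" "1 / y \<in> Zp" "y \<noteq> 0" "x \<in> Zp"
  shows "1 / x \<in> Zp" "x \<noteq> 0"
proof -
  have "x \<notin> pid 1"
  proof
    assume "x \<in> pid 1"
    with rcong_pid[OF rcong_sym[OF assms(1)] this] have "y \<in> pid 1" by simp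
    then have "y * (1 / y) \<in> pid 1" using assms(2) by (rule pid_mult_Zp)
    then show False using one_notin_pid assms(3) by simp
  qed
  then show "1 / x \<in> Zp" "x \<noteq> 0" using Zp_unit assms(4) by blast+
qed

lemma pochhammer_P_cong: "pochhammer (of_nat k * P + 1) b \<approx>[1] fact b"
  unfolding pochhammer_fact
proof (rule pochhammer_cong)
  have "of_nat k * P \<in> pid 1" by (intro pid_Zp_mult Zp_of_nat P_pid)
  then show "of_nat k * P + 1 \<approx>[1] 1" by (simp add: rcong_def)
  show "of_nat k * P + 1 \<in> Zp" by (intro Zp_add Zp_mult Zp_of_nat Zp_1)
qed (rule Zp_1)

text \<open>The left-hand side is binom(p + b - 1, b), which is p/b times a factor congruent to 1
  modulo p.\<close>

lemma lin_bdry_cong: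
  assumes "0 < b" "b < p"
  shows "lin_bdry (of_nat b) (p - 1) \<approx>[2] P / of_nat b"
proof -
  obtain c where c: "b = Suc c" using assms by (cases b) auto
  have "lin_bdry (of_nat b) (p - 1) = pochhammer P b / fact b"
    using p_gt_1 by (intro lin_bdry_of_nat) simp
  also have "\<dots> = P * (1 / fact b * pochhammer (P + 1) c)"
    by (simp add: c pochhammer_rec)
  also have "\<dots> \<approx>[1 + 1] P * (1 / fact b * fact c)"
    using pochhammer_P_cong[of 1 c]
    by (intro rcong_mult_pid P_pid rcong_mult_left inverse_fact_Zp assms(2)) simp
  also have "P * (1 / fact b * fact c) = P / of_nat b"
    by (simp add: c)
  finally show ?thesis by (simp only: one_add_one)
qed

lemma P_over_pid: "0 < b \<Longrightarrow> b < p \<Longrightarrow> P / of_nat b \<in> pid 1"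
  using pid_mult_Zp[OF P_pid Zp_inverse_less[of b]] by simp

text \<open>In \<open>lin_diff_Suc\<close> the boundary term and the star sum are both divisible by
  p, so their product drops out modulo p^2. The boundary term enters only at r = 0, as p/b; after
  that each increase of r multiplies by - 1/b.\<close>

lemma lin_diff_cong:
  assumes b: "0 < b" "b < p" and "r + 2 < p"
  shows "lin_diff (of_nat b) (p - 1) r \<approx>[2] (- 1) ^ r * (P / of_nat b - 1) / of_nat b ^ Suc r"
  using assms(3)
proof (induction r)
  have u: "1 / of_nat b \<in> Zp" "of_nat b \<noteq> (0 :: rat)" using b by (auto intro: Zp_inverse_less)
  case 0
  have "of_nat b * lin_diff (of_nat b) (p - 1) 0 \<approx>[2] P / of_nat b - 1"
    unfolding lin_diff_0 using b by (intro rcong_diff lin_bdry_cong rcong_refl)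
  also have "P / of_nat b - 1 = of_nat b * ((P / of_nat b - 1) / of_nat b)" using u by simp
  finally have "lin_diff (of_nat b) (p - 1) 0 \<approx>[2] (P / of_nat b - 1) / of_nat b"
    by (rule rcong_cancel[OF _ u])
  then show ?case by simp
next
  have u: "1 / of_nat b \<in> Zp" "of_nat b \<noteq> (0 :: rat)" using b by (auto intro: Zp_inverse_less)
  case (Suc r)
  have "lin_bdry (of_nat b) (p - 1) \<in> pid 1"
    using lin_bdry_cong[OF b] P_over_pid[OF b] by (rule rcong_pid) simp
  then have "lin_bdry (of_nat b) (p - 1) * hstar 1 (p - 1) (Suc r) \<in> pid (1 + 1)"
    using Suc.prems by (intro pid_mult hstar_pid) auto
  then have "lin_bdry (of_nat b) (p - 1) * hstar 1 (p - 1) (Suc r) \<approx>[2] 0"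
    by (simp only: rcong_0 one_add_one)
  moreover have "of_nat b * lin_diff (of_nat b) (p - 1) (Suc r)
      = lin_bdry (of_nat b) (p - 1) * hstar 1 (p - 1) (Suc r) - lin_diff (of_nat b) (p - 1) r"
    using lin_diff_Suc[of "of_nat b" "p - 1" r] by simp
  ultimately have "of_nat b * lin_diff (of_nat b) (p - 1) (Suc r)
      \<approx>[2] 0 - (- 1) ^ r * (P / of_nat b - 1) / of_nat b ^ Suc r"
    using Suc by (simp only:) (intro rcong_diff; simp)
  also have "0 - (- 1) ^ r * (P / of_nat b - 1) / of_nat b ^ Suc r
      = of_nat b * ((- 1) ^ Suc r * (P / of_nat b - 1) / of_nat b ^ Suc (Suc r))"
    using u by (simp add: divide_simps)
  finally show ?case by (rule rcong_cancel[OF _ u])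
qed

text \<open>The step from a = 0 to a = 1 stands apart: at a = 0 the recursion loses its leading term
  and \<open>lin_bdry\<close> is 1, so \<open>lin_diff\<close> is a star sum itself.\<close>

lemma lin_sum_of_nat: "lin_sum (of_nat m + 1) n r = hstar 1 n (Suc r) + (\<Sum>b=1..m. lin_diff (of_nat b) n r)"
proof (induction m)
  case 0
  have "lin_diff 0 n r = hstar 1 n (Suc r)"
    using lin_diff_Suc[of 0 n r] by (simp add: lin_bdry_def pochhammer_fact[symmetric])
  then show ?case using lin_sum_diff[of 0 n r] by (simp add: lin_sum_0)
next
  case (Suc m)
  then show ?case using lin_sum_diff[of "of_nat (Suc m)" n r] by (simp add: add.commute)
qed

section \<open>Passing from integer parameters to 1/2\<close>

lemma half_plus: "p > 2 \<Longrightarrow> 1 / 2 + P / 2 = of_nat half + 1"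
  and half_minus: "p > 2 \<Longrightarrow> 1 / 2 - P / 2 = - of_nat half"
proof -
  assume "p > 2"
  then have "P = of_nat (Suc (2 * half))" using p_odd_eq by simp
  then have P: "P = 1 + 2 * of_nat half" by simp
  show "1 / 2 + P / 2 = of_nat half + 1" unfolding P by (simp add: field_simps)
  show "1 / 2 - P / 2 = - of_nat half" unfolding P by (simp add: field_simps)
qed

lemma pochhammer_half_cong:
  assumes "p > 2"
  shows "2 * pochhammer (1 / 2) k \<approx>[2] pochhammer (of_nat half + 1) k + pochhammer (- of_nat half) k"
proof -
  have "P / 2 \<in> pid 1" using pid_mult_Zp[OF P_pid half_unit[OF assms]] by simp
  moreover have "1 / 2 + of_nat i \<in> Zp" for i
    using half_unit[OF assms] by (intro Zp_add Zp_of_nat)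
  ultimately obtain Y where Y: "\<And>s. s \<in> Zp \<Longrightarrow>
      (\<Prod>i<k. 1 / 2 + of_nat i + s * (P / 2)) \<approx>[2 * 1] (\<Prod>i<k. 1 / 2 + of_nat i) + s * (P / 2) * Y"
    using prod_perturb[of "\<lambda>i. 1 / 2 + of_nat i" "P / 2" 1 k] by blast
  have ph: "pochhammer (1 / 2 + s * (P / 2)) k = (\<Prod>i<k. 1 / 2 + of_nat i + s * (P / 2))" for s
    unfolding pochhammer_prod atLeast0LessThan by (intro prod.cong) simp_all
  \<comment> \<open>Both signs share the same Y, so the first-order terms cancel.\<close>
  have "pochhammer (1 / 2 + 1 * (P / 2)) k + pochhammer (1 / 2 + (- 1) * (P / 2)) k
      \<approx>[2 * 1] ((\<Prod>i<k. 1 / 2 + of_nat i) + 1 * (P / 2) * Y) + ((\<Prod>i<k. 1 / 2 + of_nat i) + (- 1) * (P / 2) * Y)"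
    unfolding ph by (intro rcong_add Y Zp_1 Zp_minus)
  also have "\<dots> = 2 * pochhammer (1 / 2) k"
    using ph[of 0] by simp
  also have "1 / 2 + 1 * (P / 2) = of_nat half + 1" using half_plus[OF assms] by simp
  also have "1 / 2 + (- 1) * (P / 2) = - of_nat half" using half_minus[OF assms] by simp
  finally show ?thesis by (simp add: rcong_sym)
qed

lemma lin_sum_half:
  assumes "p > 2"
  shows "2 * lin_sum (1 / 2) (p - 1) r \<approx>[2] lin_sum (of_nat half + 1) (p - 1) r + lin_sum (- of_nat half) (p - 1) r"
proof -
  let ?c = "\<lambda>k. 1 / fact k * (1 / of_nat k) * hstar 1 k r"
  have ls: "lin_sum a (p - 1) r = (\<Sum>k=1..p-1. ?c k * pochhammer a k)" for a
    by (simp add: lin_sum_def mult_ac)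
  have "2 * lin_sum (1 / 2) (p - 1) r = (\<Sum>k=1..p-1. ?c k * (2 * pochhammer (1 / 2) k))"
    unfolding ls sum_distrib_left by (intro sum.cong refl) (simp only: mult_ac)
  also have "\<dots> \<approx>[2] (\<Sum>k=1..p-1. ?c k * (pochhammer (of_nat half + 1) k + pochhammer (- of_nat half) k))"
    using assms by (intro rcong_sum rcong_mult_left pochhammer_half_cong Zp_mult inverse_fact_Zp
        Zp_inverse_less hstar_Zp) auto
  also have "\<dots> = lin_sum (of_nat half + 1) (p - 1) r + lin_sum (- of_nat half) (p - 1) r"
    unfolding ls by (simp only: distrib_left sum.distrib)
  finally show ?thesis .
qed

lemma lin_sum_half_cong:
  assumes "r + 3 < p"
  shows "2 * lin_sum (1 / 2) (p - 1) r \<approx>[2]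
    hstar 1 (p - 1) (Suc r) + (- 1) ^ r * (P * harm_pow (r + 2) half - harm_pow (r + 1) half) - harm_pow (r + 1) half"
proof -
  have p2: "p > 2" using assms by simp
  have "half \<le> p - 1" by simp
  have "2 * lin_sum (1 / 2) (p - 1) r \<approx>[2]
      hstar 1 (p - 1) (Suc r) + (\<Sum>b=1..half. lin_diff (of_nat b) (p - 1) r) + - harm_pow (r + 1) half"
    using lin_sum_half[OF p2, of r] unfolding lin_sum_of_nat lin_sum_neg[OF \<open>half \<le> p - 1\<close>] .
  also have "\<dots> \<approx>[2] hstar 1 (p - 1) (Suc r)
      + (\<Sum>b=1..half. (- 1) ^ r * (P / of_nat b - 1) / of_nat b ^ Suc r) + - harm_pow (r + 1) half"
    using assms by (intro rcong_add rcong_refl rcong_sum lin_diff_cong) auto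
  also have "(\<Sum>b=1..half. (- 1) ^ r * (P / of_nat b - 1) / of_nat b ^ Suc r)
      = (- 1) ^ r * (P * harm_pow (r + 2) half - harm_pow (r + 1) half)"
    by (simp add: harm_pow_def sum_distrib_left sum_subtractf right_diff_distrib diff_divide_distrib)
  finally show ?thesis by simp
qed

text \<open>Both corrections vanish modulo p^2: the star sum reduces to a full harmonic sum of odd
  order r + 1, and the half sum of even order r + 2 is divisible by p and carries a factor
  p.\<close>

lemma lin_sum_half_even:
  assumes "r + 3 < p" "even r"
  shows "lin_sum (1 / 2) (p - 1) r \<approx>[2] - harm_pow (r + 1) half"
proof -
  have p2: "p > 2" using assms by simp
  have "of_nat (Suc r) * hstar 1 (p - 1) (Suc r) \<approx>[2] harm_pow (1 * Suc r) (p - 1)"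
    using assms by (intro hstar_cong_harm_pow) auto
  moreover have "harm_pow (1 * Suc r) (p - 1) \<in> pid 2"
    using assms by (intro harm_pow_odd_pid) auto
  ultimately have "of_nat (Suc r) * hstar 1 (p - 1) (Suc r) \<in> pid 2"
    by (rule rcong_pid) simp
  then have h: "hstar 1 (p - 1) (Suc r) \<in> pid 2"
    using assms by (rule_tac pid_cancel) (auto intro: Zp_inverse_less simp del: of_nat_Suc)
  have "P * harm_pow (r + 2) half \<in> pid (1 + 1)"
    using assms by (intro pid_mult P_pid harm_pow_half_even_pid) auto
  then have "hstar 1 (p - 1) (Suc r) + P * harm_pow (r + 2) half \<in> pid 2"
    using h by (intro pid_add) (simp_all only: one_add_one)
  then have "(hstar 1 (p - 1) (Suc r) + P * harm_pow (r + 2) half) - 2 * harm_pow (r + 1) half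
      \<approx>[2] 0 - 2 * harm_pow (r + 1) half"
    by (intro rcong_diff rcong_refl) (simp only: rcong_0)
  with lin_sum_half_cong[OF assms(1)] assms(2)
  have "2 * lin_sum (1 / 2) (p - 1) r \<approx>[2] 2 * (- harm_pow (r + 1) half)"
    using rcong_trans by (simp add: algebra_simps)
  then show ?thesis by (rule rcong_cancel) (use half_unit[OF p2] in auto)
qed

text \<open>The two half sums of order r + 1 now cancel. After multiplication by r + 2, the star sum
  contributes p B and the half sum of order r + 2 contributes (2^(r+2) - 2) p B, which together give
  2^(r+2) - 1.\<close>

lemma lin_sum_half_odd:
  assumes "r + 3 < p" "odd r"
  shows "lin_sum (1 / 2) (p - 1) r
    \<approx>[2] (2 ^ (r + 2) - 1) / (2 * (of_nat r + 2)) * P * bernoulli (p - r - 2)"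
proof -
  define s where "s = Suc r"
  define B where "B = bernoulli (p - 1 - s)"
  have s: "even s" "1 \<le> s" "s + 2 < p" using assms by (auto simp: s_def)
  have p2: "p > 2" using assms by simp
  have "of_nat (s + 1) * (of_nat s * hstar 1 (p - 1) s) \<approx>[2] of_nat (s + 1) * harm_pow (1 * s) (p - 1)"
    using s by (intro rcong_mult_left Zp_of_nat hstar_cong_harm_pow) auto
  also have "\<dots> \<approx>[2] of_nat s * P * B"
    using harm_pow_bernoulli[of s] s by (simp add: B_def)
  finally have "of_nat s * (of_nat (s + 1) * hstar 1 (p - 1) s) \<approx>[2] of_nat s * (P * B)"
    by (simp only: mult_ac)
  then have 1: "of_nat (s + 1) * hstar 1 (p - 1) s \<approx>[2] P * B"
    by (rule rcong_cancel) (use s in \<open>auto intro!: Zp_inverse_less\<close>)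
  have "P * (of_nat (s + 1) * harm_pow (s + 1) half) \<approx>[1 + 1] P * - ((2 ^ (s + 1) - 2) * B)"
    unfolding B_def using s by (intro rcong_mult_pid P_pid harm_pow_half_bernoulli)
  then have 2: "P * (of_nat (s + 1) * harm_pow (s + 1) half) \<approx>[2] P * - ((2 ^ (s + 1) - 2) * B)"
    by (simp only: one_add_one)
  have "2 * lin_sum (1 / 2) (p - 1) r \<approx>[2] hstar 1 (p - 1) s - P * harm_pow (s + 1) half"
    using lin_sum_half_cong[OF assms(1)] assms(2) by (simp add: s_def)
  from rcong_mult_left[OF Zp_of_nat[of "s + 1"] this]
  have "of_nat (s + 1) * (2 * lin_sum (1 / 2) (p - 1) r)
      \<approx>[2] of_nat (s + 1) * hstar 1 (p - 1) s - P * (of_nat (s + 1) * harm_pow (s + 1) half)"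
    by (simp only: right_diff_distrib mult_ac)
  also have "\<dots> \<approx>[2] P * B - P * - ((2 ^ (s + 1) - 2) * B)"
    by (intro rcong_diff 1 2)
  also have "\<dots> = (2 * of_nat (s + 1)) * ((2 ^ (r + 2) - 1) / (2 * (of_nat r + 2)) * P * B)"
  proof -
    have N: "of_nat (s + 1) = (of_nat r + 2 :: rat)" by (simp add: s_def)
    have "P * B - P * - ((2 ^ (s + 1) - 2) * B) = (2 ^ (r + 2) - 1) * P * B"
      by (simp add: s_def algebra_simps)
    moreover have "(2 * of_nat (s + 1)) * (x / (2 * of_nat (s + 1)) * P * B) = x * P * B" for x :: rat
      by (simp del: of_nat_add of_nat_Suc add: of_nat_neq_0)
    ultimately show ?thesis unfolding N[symmetric] by simp
  qed
  finally have "(2 * of_nat (s + 1)) * lin_sum (1 / 2) (p - 1) r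
      \<approx>[2] (2 * of_nat (s + 1)) * ((2 ^ (r + 2) - 1) / (2 * (of_nat r + 2)) * P * B)"
    by (simp only: mult_ac)
  moreover have "1 / (2 * of_nat (s + 1)) \<in> Zp"
    using s by (intro Zp_inverse_mult half_unit p2 Zp_inverse_less) auto
  ultimately have "lin_sum (1 / 2) (p - 1) r \<approx>[2] (2 ^ (r + 2) - 1) / (2 * (of_nat r + 2)) * P * B"
    by (rule rcong_cancel) (simp flip: of_nat_Suc)
  then show ?thesis by (simp add: B_def s_def)
qed

section \<open>The quadratic sum modulo p cubed\<close>

lemma rcong_mult_pid_eq: "c \<in> pid d \<Longrightarrow> x \<approx>[e] y \<Longrightarrow> d + e = n \<Longrightarrow> c * x \<approx>[n] c * y"
  using rcong_mult_pid by blast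

text \<open>The left-hand side is a product from p to 2p + b - 1 over (p + b)!. The numerator
  contains the multiples p and 2p, the denominator only p. The remaining quotient
  \<open>X / D\<close> is a p-adic unit, needed only modulo p.\<close>

lemma lin_bdry_shift_cong:
  assumes b: "0 < b" "b < p"
  shows "lin_bdry (P + of_nat b) (p - 1) \<approx>[2] 2 * P / of_nat b"
proof -
  obtain c where c: "b = Suc c" using assms by (cases b) auto
  obtain q where q: "p = Suc q" using p_gt_1 by (cases p) auto
  have "q < p" using q by simp
  define X where "X = pochhammer (P + 1) q * pochhammer (2 * P + 1) c"
  define D where "D = fact q * pochhammer (P + 1) b"
  have split: "pochhammer P (p + b) = P * pochhammer (P + 1) q * (2 * P * pochhammer (2 * P + 1) c)"
  proof -
    have "pochhammer P p = P * pochhammer (P + 1) q" using pochhammer_rec[of P q] by (simp only: q)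
    moreover have "pochhammer (2 * P) b = 2 * P * pochhammer (2 * P + 1) c"
      unfolding c by (rule pochhammer_rec)
    moreover have "P + P = 2 * P" by simp
    ultimately show ?thesis by (simp only: pochhammer_product')
  qed
  have fct: "fact (p + b) = P * fact q * pochhammer (P + 1) b"
  proof -
    have "(fact (p + b) :: rat) = fact p * pochhammer (1 + P) b"
      by (simp only: pochhammer_fact pochhammer_product')
    moreover have "(fact p :: rat) = P * fact q" using fact_Suc[of q, where 'a = rat] by (simp only: q)
    ultimately show ?thesis by (simp add: add.commute)
  qed
  have "lin_bdry (of_nat (p + b)) (p - 1) = pochhammer P (p + b) / fact (p + b)"
    using p_gt_1 by (intro lin_bdry_of_nat) simp
  also have "\<dots> = 2 * P * (X / D)"
    unfolding split fct X_def D_def using P_nz by (simp add: mult_ac)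
  finally have lb: "lin_bdry (P + of_nat b) (p - 1) = 2 * P * (X / D)" by simp
  have X: "X \<approx>[1] fact q * fact c"
    unfolding X_def using pochhammer_P_cong[of 1 q] pochhammer_P_cong[of 2 c]
    by (intro rcong_mult) (auto intro!: pochhammer_Zp Zp_add Zp_mult Zp_of_nat Zp_1 Zp_numeral simp: pochhammer_fact)
  have D: "D \<approx>[1] fact q * fact b"
    unfolding D_def pochhammer_fact[of q] using pochhammer_P_cong[of 1 b]
    by (intro rcong_mult_left pochhammer_Zp Zp_1) simp
  have DZ: "D \<in> Zp"
    unfolding D_def pochhammer_fact by (intro Zp_mult pochhammer_Zp Zp_add Zp_1 Zp_of_nat)
  have fZ: "fact k \<in> Zp" for k unfolding pochhammer_fact by (intro pochhammer_Zp Zp_1)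
  have fu: "1 / (fact q * fact b) \<in> Zp" using \<open>q < p\<close> b by (intro Zp_inverse_mult inverse_fact_Zp)
  have fnz: "fact q * fact b \<noteq> (0 :: rat)" by simp
  have "X / D \<approx>[1] fact q * fact c / (fact q * fact b)"
    by (intro rcong_divide X D fu fnz rcong_unit[OF D fu fnz DZ] Zp_mult fZ)
  then have "P * (X / D) \<approx>[1 + 1] P * (fact q * fact c / (fact q * fact b))"
    by (rule rcong_mult_pid[OF P_pid])
  then have "2 * (P * (X / D)) \<approx>[2] 2 * (P * (fact q * fact c / (fact q * fact b)))"
    unfolding one_add_one by (rule rcong_mult_left[OF Zp_numeral])
  moreover have "2 * (P * (fact q * fact c / (fact q * fact b))) = 2 * P / of_nat b"
    by (simp add: c)
  ultimately show ?thesis by (simp only: lb mult.assoc)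
qed

text \<open>Two factors that are divisible by p and known modulo p^2 have a product known modulo
  p^3; the sign disappears because p - 1 is even.\<close>

lemma quad_bdry_shift_cong:
  assumes b: "0 < b" "b < p" and p2: "p > 2"
  shows "quad_bdry (P + of_nat b) (p - 1) \<approx>[3] 2 * P ^ 2 / of_nat b ^ 2"
proof -
  define x y where "x = lin_bdry (P + of_nat b) (p - 1)" and "y = lin_bdry (of_nat b) (p - 1)"
  have "even (p - 1)" using p_minus_1_eq[OF p2] by (metis dvd_triv_left)
  moreover have "P + of_nat b - of_nat (p - 1) - 1 = of_nat b" using p_gt_1 by (simp add: of_nat_diff)
  ultimately have "quad_bdry (P + of_nat b) (p - 1) = x * y"
    by (simp add: quad_bdry_eq_lin_bdry x_def y_def)
  have x: "x \<approx>[2] 2 * P / of_nat b" unfolding x_def using b by (rule lin_bdry_shift_cong)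
  have y: "y \<approx>[2] P / of_nat b" unfolding y_def using b by (rule lin_bdry_cong)
  have y1: "y \<in> pid 1" using y P_over_pid[OF b] by (rule rcong_pid) simp
  have "2 * P / of_nat b \<in> pid 1"
    using pid_Zp_mult[OF Zp_numeral P_over_pid[OF b]] by simp
  then have "2 * P / of_nat b * y \<approx>[3] 2 * P / of_nat b * (P / of_nat b)"
    by (rule rcong_mult_pid_eq[OF _ y]) simp
  moreover have "y * x \<approx>[3] y * (2 * P / of_nat b)"
    by (rule rcong_mult_pid_eq[OF y1 x]) simp
  then have "x * y \<approx>[3] 2 * P / of_nat b * y"
    by (simp only: mult.commute)
  ultimately have "x * y \<approx>[3] 2 * P / of_nat b * (P / of_nat b)"
    by (rule rcong_trans[rotated])
  moreover have "2 * P / of_nat b * (P / of_nat b) = 2 * P ^ 2 / of_nat b ^ 2"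
    by (simp add: power2_eq_square)
  ultimately show ?thesis using \<open>quad_bdry _ _ = x * y\<close> by simp
qed

lemma rcong_power:
  assumes "x \<approx>[e] y" "x \<in> Zp" "y \<in> Zp"
  shows "x ^ n \<approx>[e] y ^ n"
proof (induction n)
  case (Suc n)
  show ?case unfolding power_Suc by (intro rcong_mult Suc Zp_power assms)
qed (simp add: rcong_refl)

lemma quad_diff_Zp:
  assumes "a \<in> Zp"
  shows "quad_diff a (p - 1) r \<in> Zp"
proof -
  have "pochhammer (a + 1) (k - 1) * pochhammer (1 - a) (k - 1) / fact k ^ 2 * hstar 2 k r \<in> Zp"
    if "k \<in> {1..p-1}" for k
  proof -
    have k: "k < p" using that p_gt_1 by auto
    have "pochhammer (a + 1) (k - 1) * pochhammer (1 - a) (k - 1) * (1 / fact k ^ 2) * hstar 2 k r \<in> Zp"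
      using k by (intro Zp_mult pochhammer_Zp Zp_add Zp_diff Zp_1 assms Zp_inverse_power inverse_fact_Zp hstar_Zp)
    then show ?thesis by simp
  qed
  then show ?thesis unfolding quad_diff_def by (rule Zp_sum)
qed

text \<open>At a = p the leading coefficient of the recursion is p^2, so it cannot be used to pass
  from r to r + 1. Instead it is read backwards: modulo p^2 that term drops out and the boundary
  term is 1.\<close>

lemma quad_diff_P_cong: "quad_diff P (p - 1) r \<approx>[2] hstar 2 (p - 1) (Suc r)"
proof -
  let ?W = "quad_diff P (p - 1)" and ?h = "hstar 2 (p - 1) (Suc r)"
  have "quad_bdry P (p - 1) = 1 - P ^ 2 * ?W 0" using quad_diff_0[of P "p - 1"] by simp
  then have "P ^ 2 * ?W (Suc r) - ?W r = - (1 - P ^ 2 * ?W 0) * ?h"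
    using quad_diff_Suc[of P "p - 1" r] by (simp only:)
  then have "?W r - ?h = P ^ 2 * (?W (Suc r) - ?W 0 * ?h)"
    by (simp add: algebra_simps)
  also have "\<dots> \<in> pid 2"
    using p_gt_1 by (intro pid_mult_Zp pid_power Zp_diff Zp_mult quad_diff_Zp hstar_Zp Zp_of_nat) auto
  finally show ?thesis by (simp only: rcong_def)
qed

text \<open>The factor a^(2r+2) unwinds the recursion without division. For r > 0 the boundary term,
  divisible by p^2, meets a star sum divisible by p, so modulo p^3 only the one from r = 0
  remains.\<close>

lemma quad_diff_shift_cong:
  assumes b: "0 < b" "b < p" and r: "2 * r + 1 < p" and p2: "p > 2"
  shows "(P + of_nat b) ^ (2 * r + 2) * quad_diff (P + of_nat b) (p - 1) r \<approx>[3] 1 - 2 * P ^ 2 / of_nat b ^ 2"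
  using r
proof (induction r)
  case 0
  have "(P + of_nat b) ^ 2 * quad_diff (P + of_nat b) (p - 1) 0 \<approx>[3] 1 - 2 * P ^ 2 / of_nat b ^ 2"
    unfolding quad_diff_0 using b p2 by (intro rcong_diff rcong_refl quad_bdry_shift_cong)
  then show ?case by (simp add: power2_eq_square)
next
  case (Suc r)
  define a where "a = P + of_nat b"
  have aZ: "a \<in> Zp" unfolding a_def by (intro Zp_add Zp_of_nat)
  have "P ^ 2 * (2 * (1 / of_nat b ^ 2)) \<in> pid 2"
    using b by (intro pid_mult_Zp pid_power Zp_mult Zp_numeral Zp_inverse_power Zp_inverse_less)
  then have "2 * P ^ 2 / of_nat b ^ 2 \<in> pid 2" by (simp add: mult.commute)
  with quad_bdry_shift_cong[OF b p2] have "quad_bdry a (p - 1) \<in> pid 2"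
    unfolding a_def by (rule rcong_pid) simp
  then have "quad_bdry a (p - 1) * hstar 2 (p - 1) (Suc r) \<in> pid (2 + 1)"
    using Suc.prems by (intro pid_mult hstar_pid) auto
  then have "quad_bdry a (p - 1) * hstar 2 (p - 1) (Suc r) \<in> pid 3" by simp
  then have "a ^ (2 * r + 2) * (quad_bdry a (p - 1) * hstar 2 (p - 1) (Suc r)) \<in> pid 3"
    by (rule pid_Zp_mult[OF Zp_power[OF aZ]])
  moreover have "a ^ (2 * Suc r + 2) * quad_diff a (p - 1) (Suc r)
      = a ^ (2 * r + 2) * quad_diff a (p - 1) r - a ^ (2 * r + 2) * (quad_bdry a (p - 1) * hstar 2 (p - 1) (Suc r))"
  proof -
    have "a ^ 2 * quad_diff a (p - 1) (Suc r) = quad_diff a (p - 1) r - quad_bdry a (p - 1) * hstar 2 (p - 1) (Suc r)"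
      using quad_diff_Suc[of a "p - 1" r] by simp
    then have "a ^ (2 * r + 2) * (a ^ 2 * quad_diff a (p - 1) (Suc r))
      = a ^ (2 * r + 2) * (quad_diff a (p - 1) r - quad_bdry a (p - 1) * hstar 2 (p - 1) (Suc r))"
      by (rule arg_cong)
    moreover have "a ^ (2 * Suc r + 2) = a ^ (2 * r + 2) * a ^ 2"
      unfolding power_add[symmetric] by simp
    ultimately show ?thesis by (simp only: mult.assoc right_diff_distrib)
  qed
  ultimately have "a ^ (2 * Suc r + 2) * quad_diff a (p - 1) (Suc r) \<approx>[3] a ^ (2 * r + 2) * quad_diff a (p - 1) r"
    using pid_minus by (simp add: rcong_def)
  also have "\<dots> \<approx>[3] 1 - 2 * P ^ 2 / of_nat b ^ 2"
    using Suc unfolding a_def by simp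
  finally show ?case by (simp only: a_def)
qed

lemma quad_sum_step_cong:
  assumes b: "0 < b" "b < p" and r: "2 * r + 1 < p" and p2: "p > 2"
  shows "- 2 * (P + of_nat b) * quad_diff (P + of_nat b) (p - 1) r
    \<approx>[3] - 2 * (1 / of_nat (p + b) ^ (2 * r + 1)) + 4 * P ^ 2 * (1 / of_nat b ^ (2 * r + 3))"
proof -
  define a where "a = P + of_nat b"
  have a: "a = of_nat (p + b)" by (simp add: a_def)
  have "\<not> p dvd b" using b by (auto dest: dvd_imp_le)
  then have au: "1 / a \<in> Zp" unfolding a by (intro Zp_inverse_of_nat) simp
  have anz: "a \<noteq> 0" unfolding a using b by (simp del: of_nat_add)
  have bu: "1 / of_nat b \<in> Zp" using b by (intro Zp_inverse_less)
  have bnz: "of_nat b \<noteq> (0 :: rat)" using b by simp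
  have pw: "a ^ (2 * r + 2) = a * a ^ (2 * r + 1)"
    by simp
  have "- 2 * (1 / a ^ (2 * r + 1)) * (a ^ (2 * r + 2) * quad_diff a (p - 1) r)
      \<approx>[3] - 2 * (1 / a ^ (2 * r + 1)) * (1 - 2 * P ^ 2 / of_nat b ^ 2)"
    using quad_diff_shift_cong[OF assms] unfolding a_def[symmetric]
    by (intro rcong_mult_left Zp_mult Zp_minus Zp_numeral Zp_inverse_power au)
  also have "- 2 * (1 / a ^ (2 * r + 1)) * (1 - 2 * P ^ 2 / of_nat b ^ 2)
      = - 2 * (1 / a ^ (2 * r + 1)) + P ^ 2 * (4 * (1 / of_nat b ^ 2) * (1 / a ^ (2 * r + 1)))"
    by (simp add: algebra_simps)
  also have "\<dots> \<approx>[3] - 2 * (1 / a ^ (2 * r + 1)) + P ^ 2 * (4 * (1 / of_nat b ^ 2) * (1 / of_nat b ^ (2 * r + 1)))"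
  proof -
    \<comment> \<open>Behind the factor p^2 only residues modulo p matter, so p + b may be replaced
      by b there.\<close>
    have "a \<approx>[1] of_nat b" using P_pid by (simp add: a_def rcong_def)
    then have "a ^ (2 * r + 1) \<approx>[1] of_nat b ^ (2 * r + 1)"
      by (rule rcong_power) (simp_all only: a Zp_of_nat)
    from rcong_divide[OF rcong_refl this, of 1]
    have "1 / a ^ (2 * r + 1) \<approx>[1] 1 / of_nat b ^ (2 * r + 1)"
      using anz bnz au bu by (simp add: Zp_inverse_power Zp_power Zp_of_nat Zp_1 del: power_Suc)
    then have "4 * (1 / of_nat b ^ 2) * (1 / a ^ (2 * r + 1))
        \<approx>[1] 4 * (1 / of_nat b ^ 2) * (1 / of_nat b ^ (2 * r + 1))"
      by (intro rcong_mult_left Zp_mult Zp_numeral Zp_inverse_power bu)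
    then have "P ^ 2 * (4 * (1 / of_nat b ^ 2) * (1 / a ^ (2 * r + 1)))
        \<approx>[3] P ^ 2 * (4 * (1 / of_nat b ^ 2) * (1 / of_nat b ^ (2 * r + 1)))"
      by (rule rcong_mult_pid_eq[OF pid_power]) simp
    then show ?thesis by (rule rcong_add[OF rcong_refl])
  qed
  also have "P ^ 2 * (4 * (1 / of_nat b ^ 2) * (1 / of_nat b ^ (2 * r + 1))) = 4 * P ^ 2 * (1 / of_nat b ^ (2 * r + 3))"
    by (simp add: eval_nat_numeral mult_ac)
  finally have "- 2 * (1 / a ^ (2 * r + 1)) * (a ^ (2 * r + 2) * quad_diff a (p - 1) r)
      \<approx>[3] - 2 * (1 / a ^ (2 * r + 1)) + 4 * P ^ 2 * (1 / of_nat b ^ (2 * r + 3))"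
    by simp
  moreover have "- 2 * (1 / a ^ (2 * r + 1)) * (a ^ (2 * r + 2) * quad_diff a (p - 1) r) = - 2 * a * quad_diff a (p - 1) r"
    unfolding pw using anz by simp
  ultimately show ?thesis by (simp only: a_def of_nat_add)
qed

lemma quad_sum_shift:
  "quad_sum (P + of_nat m + 1) (p - 1) r = quad_sum P (p - 1) r - 2 * P * quad_diff P (p - 1) r
    + (\<Sum>b=1..m. - 2 * (P + of_nat b) * quad_diff (P + of_nat b) (p - 1) r)"
proof (induction m)
  case 0
  show ?case using quad_sum_diff[of P "p - 1" r] by simp
next
  case (Suc m)
  have "quad_sum (P + of_nat (Suc m) + 1) (p - 1) r = quad_sum (P + of_nat (Suc m)) (p - 1) r
      + - 2 * (P + of_nat (Suc m)) * quad_diff (P + of_nat (Suc m)) (p - 1) r"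
    using quad_sum_diff[of "P + of_nat (Suc m)" "p - 1" r] by simp
  moreover have "P + of_nat (Suc m) = P + of_nat m + 1" by simp
  moreover have "(\<Sum>b=1..Suc m. f b) = (\<Sum>b=1..m. f b) + f (Suc m)" for f :: "nat \<Rightarrow> rat" by simp
  ultimately show ?case using Suc by (simp only: add.assoc)
qed

lemma quad_sum_P: "quad_sum P (p - 1) r = - 2 * harm_pow (2 * r + 1) (p - 1)"
  using quad_sum_of_nat[of "p - 1" "p - 1" r] p_gt_1 by (simp add: of_nat_diff)

text \<open>The full harmonic sum from \<open>quad_sum_P\<close> is folded. Its upper half, with
  indices p - b, joins the inverse powers of p + b from the steps beyond a = p; since the exponent
  is odd, \<open>inverse_power_odd_pair\<close> gives the precision p^3.\<close>

lemma quad_sum_shift_cong: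
  assumes r: "2 * r + 1 < p" and p2: "p > 2"
  shows "quad_sum (P + of_nat half + 1) (p - 1) r \<approx>[3]
    - 2 * harm_pow (2 * r + 1) half
    + 4 * of_nat (2 * r + 1) * P * harm_pow (2 * r + 2) half
    - 2 * P * hstar 2 (p - 1) (Suc r)
    + 4 * P ^ 2 * harm_pow (2 * r + 3) half"
proof -
  let ?t = "2 * r + 1"
  have "P * quad_diff P (p - 1) r \<approx>[3] P * hstar 2 (p - 1) (Suc r)"
    by (rule rcong_mult_pid_eq[OF P_pid quad_diff_P_cong]) simp
  then have 1: "2 * (P * quad_diff P (p - 1) r) \<approx>[3] 2 * (P * hstar 2 (p - 1) (Suc r))"
    by (rule rcong_mult_left[OF Zp_numeral])
  have "quad_sum (P + of_nat half + 1) (p - 1) r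
      = - 2 * harm_pow ?t (p - 1) - 2 * (P * quad_diff P (p - 1) r)
      + (\<Sum>b=1..half. - 2 * (P + of_nat b) * quad_diff (P + of_nat b) (p - 1) r)"
    by (simp only: quad_sum_shift quad_sum_P mult.assoc)
  also have "\<dots> \<approx>[3] - 2 * harm_pow ?t (p - 1) - 2 * (P * hstar 2 (p - 1) (Suc r))
      + (\<Sum>b=1..half. - 2 * (1 / of_nat (p + b) ^ ?t) + 4 * P ^ 2 * (1 / of_nat b ^ (2 * r + 3)))"
  proof (intro rcong_add rcong_diff rcong_refl 1 rcong_sum)
    fix b assume "b \<in> {1..half}"
    then have "0 < b" "b < p" using p2 by auto
    then show "- 2 * (P + of_nat b) * quad_diff (P + of_nat b) (p - 1) r
      \<approx>[3] - 2 * (1 / of_nat (p + b) ^ ?t) + 4 * P ^ 2 * (1 / of_nat b ^ (2 * r + 3))"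
      using assms by (intro quad_sum_step_cong)
  qed
  also have "\<dots> = - 2 * harm_pow ?t half
      - 2 * (\<Sum>b=1..half. 1 / of_nat (p + b) ^ ?t + 1 / of_nat (p - b) ^ ?t)
      - 2 * P * hstar 2 (p - 1) (Suc r) + 4 * P ^ 2 * harm_pow (2 * r + 3) half"
  proof -
    have "harm_pow ?t (p - 1) = harm_pow ?t half + (\<Sum>b=1..half. 1 / of_nat (p - b) ^ ?t)"
      using sum_fold_p(1)[OF p2, of "\<lambda>j. 1 / of_nat j ^ ?t"] by (simp only: harm_pow_def sum.distrib)
    moreover have "(\<Sum>b=1..half. - 2 * (1 / of_nat (p + b) ^ ?t) + 4 * P ^ 2 * (1 / of_nat b ^ (2 * r + 3)))
        = - 2 * (\<Sum>b=1..half. 1 / of_nat (p + b) ^ ?t) + 4 * P ^ 2 * harm_pow (2 * r + 3) half"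
      by (simp only: harm_pow_def sum.distrib sum_distrib_left)
    ultimately show ?thesis by (simp only: sum.distrib) (simp add: algebra_simps)
  qed
  also have "\<dots> \<approx>[3] - 2 * harm_pow ?t half
      - 2 * (\<Sum>b=1..half. - 2 * of_nat ?t * P / of_nat b ^ Suc ?t)
      - 2 * P * hstar 2 (p - 1) (Suc r) + 4 * P ^ 2 * harm_pow (2 * r + 3) half"
    using p2 by (intro rcong_add rcong_diff rcong_refl rcong_mult_left Zp_numeral rcong_sum inverse_power_odd_pair) auto
  also have "(\<Sum>b=1..half. - 2 * of_nat ?t * P / of_nat b ^ Suc ?t) = - 2 * of_nat ?t * P * harm_pow (2 * r + 2) half"
    by (simp add: harm_pow_def sum_distrib_left)
  finally show ?thesis by (simp add: algebra_simps)
qed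

section \<open>Extrapolation and assembly of the quadratic congruence\<close>

lemma pochhammer_half_sq_cong:
  assumes "p > 2"
  shows "8 * pochhammer (1 / 2) k ^ 2 \<approx>[3]
    9 * (pochhammer (of_nat half + 1) k * pochhammer (1 - (of_nat half + 1)) k)
    - pochhammer (P + of_nat half + 1) k * pochhammer (1 - (P + of_nat half + 1)) k"
proof -
  \<comment> \<open>With \<open>s = w\<^sup>2\<close>, the value at \<open>1/2 + w p/2\<close> is \<open>\<Prod>i<k. c i + s v\<close>, affine in \<open>s\<close> modulo \<open>p\<^sup>4\<close>.\<close>
  define v where "v = - (P ^ 2 / 4)"
  define c :: "nat \<Rightarrow> rat" where "c i = (1 / 2 + of_nat i) ^ 2" for i
  have "P ^ 2 * (1 / 2 * (1 / 2)) \<in> pid 2"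
    using half_unit[OF assms] by (intro pid_mult_Zp pid_power Zp_mult)
  then have v: "v \<in> pid 2" using pid_minus by (simp add: v_def)
  have "c i \<in> Zp" for i unfolding c_def
    using half_unit[OF assms] by (intro Zp_power Zp_add Zp_of_nat)
  with v obtain Y where Y: "\<And>s. s \<in> Zp \<Longrightarrow>
      (\<Prod>i<k. c i + s * v) \<approx>[2 * 2] (\<Prod>i<k. c i) + s * v * Y"
    using prod_perturb[of c v 2 k] by blast
  have Y': "(\<Prod>i<k. c i + s * v) \<approx>[3] (\<Prod>i<k. c i) + s * v * Y" if "s \<in> Zp" for s
    using rcong_mono[OF Y[OF that], of 3] by simp
  \<comment> \<open>With x = w p / 2, the complement of 1/2 + x is 1/2 - x, so the i-th factors
    multiply to (1/2 + i)^2 - x^2.\<close>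
  have ph: "pochhammer (1 / 2 + w * (P / 2)) k * pochhammer (1 - (1 / 2 + w * (P / 2))) k
      = (\<Prod>i<k. c i + w ^ 2 * v)" for w
    unfolding pochhammer_prod atLeast0LessThan prod.distrib[symmetric] c_def v_def
    by (intro prod.cong refl) (simp add: field_simps power2_eq_square)
  have e1: "1 / 2 + 1 * (P / 2) = of_nat half + 1" using half_plus[OF assms] by simp
  have e3: "1 / 2 + 3 * (P / 2) = P + of_nat half + 1" using half_plus[OF assms] by simp
  \<comment> \<open>The weights extrapolate an affine function from s = 1 and s = 9 to s = 0: 9 f(1)
    - f(9) = 8 f(0).\<close>
  have "9 * (\<Prod>i<k. c i + 1 ^ 2 * v) - (\<Prod>i<k. c i + 3 ^ 2 * v)
      \<approx>[3] 9 * ((\<Prod>i<k. c i) + 1 ^ 2 * v * Y) - ((\<Prod>i<k. c i) + 3 ^ 2 * v * Y)"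
    by (intro rcong_diff rcong_mult_left Y' Zp_numeral Zp_power Zp_1)
  also have "\<dots> = 8 * (\<Prod>i<k. c i)" by (simp add: algebra_simps)
  also have "(\<Prod>i<k. c i) = pochhammer (1 / 2) k ^ 2"
    using ph[of 0] by (simp add: power2_eq_square)
  finally show ?thesis
    unfolding ph[symmetric] e1 e3 by (rule rcong_sym)
qed

lemma quad_sum_half:
  assumes "p > 2"
  shows "8 * quad_sum (1 / 2) (p - 1) r \<approx>[3]
    9 * quad_sum (of_nat half + 1) (p - 1) r - quad_sum (P + of_nat half + 1) (p - 1) r"
proof -
  let ?c = "\<lambda>k. 1 / fact k ^ 2 * (1 / of_nat k) * hstar 2 k r"
  let ?f = "\<lambda>a k. pochhammer a k * pochhammer (1 - a) k"
  have qs: "quad_sum a (p - 1) r = (\<Sum>k=1..p-1. ?c k * ?f a k)" for a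
    unfolding quad_sum_def by (intro sum.cong refl) (simp add: mult_ac)
  have "8 * quad_sum (1 / 2) (p - 1) r = (\<Sum>k=1..p-1. ?c k * (8 * pochhammer (1 / 2) k ^ 2))"
    unfolding qs sum_distrib_left by (intro sum.cong refl) (simp add: power2_eq_square)
  also have "\<dots> \<approx>[3] (\<Sum>k=1..p-1. ?c k * (9 * ?f (of_nat half + 1) k - ?f (P + of_nat half + 1) k))"
    using assms by (intro rcong_sum rcong_mult_left pochhammer_half_sq_cong Zp_mult Zp_inverse_power inverse_fact_Zp
        Zp_inverse_less hstar_Zp) auto
  also have "\<dots> = 9 * quad_sum (of_nat half + 1) (p - 1) r - quad_sum (P + of_nat half + 1) (p - 1) r"
    unfolding qs sum_distrib_left sum_subtractf[symmetric]
    by (intro sum.cong refl) (simp only: right_diff_distrib mult.left_commute)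
  finally show ?thesis .
qed

lemma quad_sum_half_cong:
  assumes "2 * r + 3 < p"
  shows "quad_sum (1 / 2) (p - 1) r \<approx>[3] - 2 * harm_pow (2 * r + 1) half
         - of_nat r * (2 ^ (2 * r + 3) - 1) / 2 * P ^ 2 * bernoulli (p - 2 * r - 3)"
proof -
  have p2: "p > 2" using assms by simp
  define s where "s = 2 * r + 2"
  define N :: rat where "N = of_nat (s + 1)"
  define B where "B = bernoulli (p - 1 - s)"
  define M :: rat where "M = 2 ^ (s + 1) - 2"
  define h where "h = hstar 2 (p - 1) (Suc r)"
  define R :: rat where "R = of_nat r"
  have s: "even s" "1 \<le> s" "s + 2 \<le> p" "s + 1 < p" using assms by (auto simp: s_def)
  \<comment> \<open>The assumption yields only s + 2 <= p; equality is excluded by parity, p being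
    odd.\<close>
  have "s + 2 < p"
  proof (rule ccontr)
    assume "\<not> ?thesis"
    then have "p = s + 2" using s by simp
    then show False using s p_odd_eq[OF p2] by (metis dvd_add_triv_right_iff even_Suc even_mult_iff dvd_refl)
  qed
  have sR: "of_nat s = 2 * R + 2" and NR: "N = 2 * R + 3" by (simp_all add: s_def R_def N_def)
  have NZ: "N \<in> Zp" "1 / N \<in> Zp" "N \<noteq> 0"
    unfolding N_def using s by (auto intro!: Zp_of_nat Zp_inverse_less simp del: of_nat_add of_nat_Suc)
  have A: "N * harm_pow s (p - 1) \<approx>[2] of_nat s * P * B"
    unfolding N_def B_def using s \<open>s + 2 < p\<close> by (intro harm_pow_bernoulli)
  have PC: "P * (N * harm_pow (s + 1) half) \<approx>[1 + 1] P * - (M * B)"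
    unfolding N_def B_def M_def using s \<open>s + 2 < p\<close> by (intro rcong_mult_pid P_pid harm_pow_half_bernoulli)
  then have C: "P * (N * harm_pow (s + 1) half) \<approx>[2] - (M * P * B)"
    by (simp only: one_add_one) (simp add: mult_ac)
  have F: "N * harm_pow s (p - 1) \<approx>[2] N * (2 * harm_pow s half + of_nat s * P * harm_pow (s + 1) half)"
    using s by (intro rcong_mult_left NZ harm_pow_fold p2)
  have F': "of_nat s * (P * (N * harm_pow (s + 1) half)) \<approx>[2] of_nat s * - (M * P * B)"
    by (intro rcong_mult_left Zp_of_nat C)
  \<comment> \<open>The folding relation is solved for the half sum of order s, the one of order s +
    1 being removed by \<open>C\<close>.\<close>
  have half_s: "N * (2 * harm_pow s half) \<approx>[2] of_nat s * P * B * (M + 1)"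
  proof -
    have "N * (2 * harm_pow s half + of_nat s * P * harm_pow (s + 1) half) - of_nat s * (P * (N * harm_pow (s + 1) half))
        \<approx>[2] of_nat s * P * B - of_nat s * - (M * P * B)"
      by (intro rcong_diff F' rcong_trans[OF rcong_sym[OF F] A])
    then show ?thesis by (simp add: algebra_simps)
  qed
  have hs: "N * h \<approx>[2] 2 * (P * B)"
  proof -
    have "of_nat (Suc r) * h \<approx>[2] harm_pow (2 * Suc r) (p - 1)"
      unfolding h_def using assms by (intro hstar_cong_harm_pow) auto
    then have "N * (of_nat (Suc r) * h) \<approx>[2] N * harm_pow s (p - 1)"
      by (intro rcong_mult_left NZ) (simp add: s_def)
    also note A
    also have "of_nat s * P * B = of_nat (Suc r) * (2 * (P * B))" by (simp add: s_def algebra_simps)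
    finally have "of_nat (Suc r) * (N * h) \<approx>[2] of_nat (Suc r) * (2 * (P * B))" by (simp only: mult_ac)
    then show ?thesis by (rule rcong_cancel) (use assms in \<open>auto intro!: Zp_inverse_less simp del: of_nat_Suc\<close>)
  qed
  define G where "G = quad_sum (P + of_nat half + 1) (p - 1) r"
  define Hm where "Hm = harm_pow (2 * r + 1) half"
  have G: "G \<approx>[3] - 2 * Hm + 4 * of_nat (2 * r + 1) * P * harm_pow s half - 2 * P * h + 4 * P ^ 2 * harm_pow (s + 1) half"
  proof -
    have "2 * r + 2 = s" "2 * r + 3 = s + 1" "2 * r + 1 < p" using assms by (simp_all add: s_def)
    then show ?thesis using quad_sum_shift_cong[of r] p2 unfolding G_def Hm_def h_def by (simp only:)
  qed
  have "N * G \<approx>[3] N * (- 2 * Hm + 4 * of_nat (2 * r + 1) * P * harm_pow s half - 2 * P * h + 4 * P ^ 2 * harm_pow (s + 1) half)"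
    by (intro rcong_mult_left NZ G)
  also have "\<dots> = - 2 * N * Hm + P * (2 * of_nat (2 * r + 1) * (N * (2 * harm_pow s half)) - 2 * (N * h) + 4 * (P * (N * harm_pow (s + 1) half)))"
    by (simp add: algebra_simps power2_eq_square)
  also have "\<dots> \<approx>[3] - 2 * N * Hm + P * (2 * of_nat (2 * r + 1) * (of_nat s * P * B * (M + 1)) - 2 * (2 * (P * B)) + 4 * - (M * P * B))"
  proof (intro rcong_add[OF rcong_refl] rcong_mult_pid_eq[OF P_pid])
    show "2 * of_nat (2 * r + 1) * (N * (2 * harm_pow s half)) - 2 * (N * h) + 4 * (P * (N * harm_pow (s + 1) half))
      \<approx>[2] 2 * of_nat (2 * r + 1) * (of_nat s * P * B * (M + 1)) - 2 * (2 * (P * B)) + 4 * - (M * P * B)"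
      by (intro rcong_add rcong_diff rcong_mult_left Zp_mult Zp_numeral Zp_of_nat half_s hs C)
  qed simp
  \<comment> \<open>The bracket is (M + 1) p B times 2 (2R + 1)(2R + 2) - 4 = 4R (2R + 3) = 4 R N.
    This produces the factor r and lets N cancel.\<close>
  also have "\<dots> = N * (- 2 * Hm + 4 * R * (M + 1) * P ^ 2 * B)"
    unfolding sR NR by (simp add: R_def algebra_simps power2_eq_square)
  finally have "N * G \<approx>[3] N * (- 2 * Hm + 4 * R * (M + 1) * P ^ 2 * B)" by simp
  then have G': "G \<approx>[3] - 2 * Hm + 4 * R * (M + 1) * P ^ 2 * B"
    by (rule rcong_cancel[OF _ NZ(2,3)])
  have "half \<le> p - 1" by simp
  then have "quad_sum (of_nat half + 1) (p - 1) r = - 2 * Hm"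
    unfolding Hm_def by (rule quad_sum_of_nat)
  then have "8 * quad_sum (1 / 2) (p - 1) r \<approx>[3] 9 * (- 2 * Hm) - G"
    using quad_sum_half[OF p2, of r] by (simp only: G_def)
  also have "\<dots> \<approx>[3] 9 * (- 2 * Hm) - (- 2 * Hm + 4 * R * (M + 1) * P ^ 2 * B)"
    by (intro rcong_diff rcong_refl G')
  also have "\<dots> = 8 * (- 2 * Hm - R * (M + 1) / 2 * P ^ 2 * B)"
    by (simp add: algebra_simps)
  finally have *: "8 * quad_sum (1 / 2) (p - 1) r \<approx>[3] 8 * (- 2 * Hm - R * (M + 1) / 2 * P ^ 2 * B)" .
  have "1 / 2 * (1 / 2) * (1 / 2) \<in> Zp" using half_unit[OF p2] by (intro Zp_mult)
  then have "quad_sum (1 / 2) (p - 1) r \<approx>[3] - 2 * Hm - R * (M + 1) / 2 * P ^ 2 * B"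
    using * by (rule_tac rcong_cancel[of 8]) simp_all
  moreover have "M + 1 = 2 ^ (2 * r + 3) - 1"
    by (simp add: M_def s_def eval_nat_numeral)
  moreover have "p - 1 - s = p - 2 * r - 3" by (simp add: s_def)
  ultimately show ?thesis by (simp only: B_def R_def Hm_def)
qed

end

theorem mainTheorem2:
  fixes p r :: nat
  assumes "prime p"
  shows "(p > r + 3 \<longrightarrow>
      rat_cong_pow p 2
        (\<Sum>k=1..p-1. of_nat ((2 * k) choose k) / (of_nat k * 4 ^ k)
            * mult_harm_star k (replicate r 1))
        (if even r then - harm_pow (r + 1) ((p - 1) div 2)
         else (2 ^ (r + 2) - 1) / (2 * (of_nat r + 2)) * of_nat p * bernoulli (p - r - 2)))
    \<and> (p > 2 * r + 3 \<longrightarrow>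
      rat_cong_pow p 3
        (\<Sum>k=1..p-1. of_nat ((2 * k) choose k) ^ 2 / (of_nat k * 16 ^ k)
            * mult_harm_star k (replicate r 2))
        (- 2 * harm_pow (2 * r + 1) ((p - 1) div 2)
         - of_nat r * (2 ^ (2 * r + 3) - 1) / 2 * of_nat p ^ 2 * bernoulli (p - 2 * r - 3)))"
proof -
  interpret localization p by unfold_locales (rule assms)
  have lin: "(\<Sum>k=1..p-1. of_nat ((2 * k) choose k) / (of_nat k * 4 ^ k) * mult_harm_star k (replicate r 1))
      = lin_sum (1 / 2) (p - 1) r"
    unfolding lin_sum_def hstar_def central_binomial_pochhammer by (intro sum.cong refl) simp
  have quad: "(\<Sum>k=1..p-1. of_nat ((2 * k) choose k) ^ 2 / (of_nat k * 16 ^ k) * mult_harm_star k (replicate r 2))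
      = quad_sum (1 / 2) (p - 1) r"
  proof -
    have "(16 :: rat) ^ k = (4 ^ k) ^ 2" for k
      by (simp flip: power_mult add: mult.commute[of k] power_mult)
    then show ?thesis
      unfolding quad_sum_def hstar_def central_binomial_pochhammer
      by (intro sum.cong refl) (simp add: power_divide power_mult_distrib power2_eq_square)
  qed
  show ?thesis unfolding lin quad
  \<comment> \<open>Besides each congruence, only integrality of the right-hand side remains to be
    shown; that of the sum follows from the two.\<close>
  proof (intro conjI impI rcong_imp_rat_cong_pow)
    assume r: "p > r + 3"
    show "lin_sum (1 / 2) (p - 1) r \<approx>[2] (if even r then - harm_pow (r + 1) half
         else (2 ^ (r + 2) - 1) / (2 * (of_nat r + 2)) * P * bernoulli (p - r - 2))"
      using r lin_sum_half_even[of r] lin_sum_half_odd[of r] by simp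
    have "of_nat r + 2 = (of_nat (r + 2) :: rat)" by simp
    moreover have "1 / (2 * of_nat (r + 2)) \<in> Zp"
      using r by (intro Zp_inverse_mult half_unit Zp_inverse_less) auto
    moreover have "2 ^ (r + 2) - 1 \<in> Zp" by (intro Zp_diff Zp_power Zp_numeral Zp_1)
    ultimately have "(2 ^ (r + 2) - 1) / (2 * (of_nat r + 2)) \<in> Zp"
      by (simp only: Zp_divide)
    moreover have "bernoulli (p - r - 2) \<in> Zp" if "odd r"
      using power_sum_cong_bernoulli[of "p - r - 2"] r by simp
    moreover have "harm_pow (r + 1) half \<in> Zp"
      using r by (intro harm_pow_Zp) simp
    ultimately show "(if even r then - harm_pow (r + 1) half
         else (2 ^ (r + 2) - 1) / (2 * (of_nat r + 2)) * P * bernoulli (p - r - 2)) \<in> Zp"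
      by (cases "even r") (simp_all only: if_True if_False Zp_minus Zp_mult Zp_of_nat not_False_eq_True)
  next
    assume r: "p > 2 * r + 3"
    show "quad_sum (1 / 2) (p - 1) r \<approx>[3] - 2 * harm_pow (2 * r + 1) half
         - of_nat r * (2 ^ (2 * r + 3) - 1) / 2 * P ^ 2 * bernoulli (p - 2 * r - 3)"
      using r by (intro quad_sum_half_cong) simp
    have "harm_pow (2 * r + 1) half \<in> Zp"
      using r by (intro harm_pow_Zp) simp
    moreover have "bernoulli (p - 2 * r - 3) \<in> Zp"
      using power_sum_cong_bernoulli[of "p - 2 * r - 3"] r by simp
    moreover have "of_nat r * (2 ^ (2 * r + 3) - 1) * (1 / 2) \<in> Zp"
      using r by (intro Zp_mult Zp_of_nat Zp_diff Zp_power Zp_numeral Zp_1 half_unit) simp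
    ultimately show "- 2 * harm_pow (2 * r + 1) half
         - of_nat r * (2 ^ (2 * r + 3) - 1) / 2 * P ^ 2 * bernoulli (p - 2 * r - 3) \<in> Zp"
      by (intro Zp_diff Zp_mult Zp_minus Zp_numeral Zp_power Zp_of_nat) simp_all
  qed
qed

end
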